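(* Let $0<\alpha<1$, let $A$ be a closed linear operator on a Banach space $X$, and suppose that $A$ generates the $(\alpha,\alpha)$-resolvent family $\{S_{\alpha,\alpha}(t)\}_{t\ge 0}$. Let $x\in X$ and $T>0$, and let $u(t;x)=S_{\alpha,\alpha}(t)x$ be the solution of ${}^R\partial_t^\alpha u(t)=Au(t)$, $t>0$, $(g_{1-\alpha}\ast u)(0)=x$ (Riemann-Liouville derivative). Then the order $\alpha$ satisfies $$\int_0^T r\,u(r;x)\,dr=\alpha\,\psi_T(x),$$ where $\psi_t(x):=A(g_2\ast S_{\alpha,\alpha}\ast S_{\alpha,\alpha})(t)x+(g_2\ast S_{\alpha,\alpha})(t)x=A(g_2\ast S_{\alpha,\alpha}\ast u)(t;x)+(g_2\ast u)(t;x)$.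
   Context: Conventions. For $\gamma>0$, $g_\gamma(t):=t^{\gamma-1}/\Gamma(\gamma)$ (so $g_2(t)=t$). The finite convolution is $(f\ast g)(t):=\int_0^t f(t-s)g(s)\,ds$, used also for operator-valued functions and for operator-valued with vector-valued functions, e.g. $(S_{\alpha,\alpha}\ast u)(t;x)=\int_0^t S_{\alpha,\alpha}(t-s)u(s;x)\,ds$. For $0<\alpha<1$ the Riemann-Liouville derivative is ${}^R\partial_t^\alpha f(t)=\frac{d}{dt}\int_0^t g_{1-\alpha}(t-s)f(s)\,ds$. Resolvent families. Let $A$ be a closed linear operator on a Banach space $X$ and $\alpha,\beta>0$. $A$ is the generator of an $(\alpha,\beta)$-resolvent family if there exist $\omega\ge 0$ and a strongly continuous function $S_{\alpha,\beta}:(0,\infty)\to\mathcal{B}(X)$ (bounded linear operators on $X$) that is exponentially bounded (there are $M>0$, $w\in\mathbb{R}$ with $\|S_{\alpha,\beta}(t)\|\le Me^{wt}$ for $t>0$), with $\{\lambda^\alpha:\mathrm{Re}\,\lambda>\omega\}\subset\rho(A)$, such that for all $x\in X$ and $\mathrm{Re}\,\lambda>\omega$, $\lambda^{\alpha-\beta}(\lambda^\alpha-A)^{-1}x=\int_0^\infty e^{-\lambda t}S_{\alpha,\beta}(t)x\,dt$. Then $\{S_{\alpha,\beta}(t)\}$ is called the $(\alpha,\beta)$-resolvent family generated by $A$. *)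

theory Defs
  imports "HOL-Analysis.Analysis"
begin

text \<open>Complex Banach spaces: the library only has real ones.\<close>

class complex_banach = banach +
  fixes scaleC :: "complex \<Rightarrow> 'a \<Rightarrow> 'a"  (infixr "*\<^sub>C" 75)
  assumes scaleC_add_right: "a *\<^sub>C (x + y) = a *\<^sub>C x + a *\<^sub>C y"
    and scaleC_add_left: "(a + b) *\<^sub>C x = a *\<^sub>C x + b *\<^sub>C x"
    and scaleC_scaleC: "a *\<^sub>C (b *\<^sub>C x) = (a * b) *\<^sub>C x"
    and scaleC_one: "1 *\<^sub>C x = x"
    and scaleC_of_real: "complex_of_real r *\<^sub>C x = r *\<^sub>R x"
    and norm_scaleC: "norm (a *\<^sub>C x) = cmod a * norm x"

text \<open>An unbounded operator is a pair of a domain \<open>D\<close> and a function \<open>A\<close>; the values of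
  \<open>A\<close> outside \<open>D\<close> carry no meaning. The domain need not be dense.\<close>

definition closed_linear_operator :: "'a::complex_banach set \<Rightarrow> ('a \<Rightarrow> 'a) \<Rightarrow> bool" where
  "closed_linear_operator D A \<longleftrightarrow>
     0 \<in> D \<and>
     (\<forall>x\<in>D. \<forall>y\<in>D. x + y \<in> D \<and> A (x + y) = A x + A y) \<and>
     (\<forall>c. \<forall>x\<in>D. c *\<^sub>C x \<in> D \<and> A (c *\<^sub>C x) = c *\<^sub>C A x) \<and>
     closed ((\<lambda>x. (x, A x)) ` D)"

definition resolvent :: "'a::complex_banach set \<Rightarrow> ('a \<Rightarrow> 'a) \<Rightarrow> complex \<Rightarrow> 'a \<Rightarrow> 'a" where
  "resolvent D A \<mu> = the_inv_into D (\<lambda>y. \<mu> *\<^sub>C y - A y)"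

definition resolvent_set :: "'a::complex_banach set \<Rightarrow> ('a \<Rightarrow> 'a) \<Rightarrow> complex set" where
  "resolvent_set D A =
     {\<mu>. bij_betw (\<lambda>y. \<mu> *\<^sub>C y - A y) D UNIV \<and> bounded_linear (resolvent D A \<mu>)}"

text \<open>Exponential boundedness of a family on \<open>(0,\<infinity>)\<close>. Demanding
  \<open>norm (S t) \<le> M * exp (w * t)\<close> down to \<open>t = 0\<close> would be too much for
  \<open>(\<alpha>,\<alpha>)\<close>-resolvent families with \<open>\<alpha> < 1\<close>, which behave like
  \<open>t powr (\<alpha> - 1)\<close> at \<open>0\<close>: it would give
  \<open>\<parallel>(\<mu> - A)\<^sup>-\<^sup>1\<parallel> \<le> M / (\<mu> powr (1/\<alpha>) - w)\<close> for large real \<open>\<mu>\<close>, whereas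
  \<open>\<mu> (\<mu> - A)\<^sup>-\<^sup>1 x\<close> tends to \<open>x\<close> for \<open>x\<close> in the domain, so the space would be trivial.
  Hence the bound is required away from \<open>0\<close>, together with integrability of the norm
  near \<open>0\<close>. The uniform bound is a special case, as shown by
  \<open>exponentially_bounded_if_uniform\<close>.\<close>

definition exponentially_bounded :: "(real \<Rightarrow> 'a::real_normed_vector \<Rightarrow>\<^sub>L 'a) \<Rightarrow> bool" where
  "exponentially_bounded S \<longleftrightarrow>
     (\<exists>M>0. \<exists>w. \<forall>t\<ge>1. norm (S t) \<le> M * exp (w * t)) \<and>
     (\<lambda>t. norm (S t)) integrable_on {0<..1}"

definition strongly_continuous :: "(real \<Rightarrow> 'a::real_normed_vector \<Rightarrow>\<^sub>L 'a) \<Rightarrow> bool" where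
  "strongly_continuous S \<longleftrightarrow> (\<forall>x. continuous_on {0<..} (\<lambda>t. blinfun_apply (S t) x))"

lemma exponentially_bounded_if_uniform:
  fixes S :: "real \<Rightarrow> 'a::real_normed_vector \<Rightarrow>\<^sub>L 'a"
  assumes cont: "strongly_continuous S"
    and "M > 0" and bound: "\<And>t. t > 0 \<Longrightarrow> norm (S t) \<le> M * exp (w * t)"
  shows "exponentially_bounded S"
proof -
  have lsc: "open {t \<in> {0<..}. a < norm (S t)}" for a
  proof -
    have "{t \<in> {0<..}. a < norm (S t)} =
        (if a < 0 then {0<..} else (\<Union>x. {t \<in> {0<..}. a * norm x < norm (S t x)}))"
    proof (cases "a < 0")
      case True
      then show ?thesis
        by (auto intro: less_le_trans)
    next
      case False
      have "a < norm (S t) \<longleftrightarrow> (\<exists>x. a * norm x < norm (S t x))" for t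
      proof
        assume "a < norm (S t)"
        show "\<exists>x. a * norm x < norm (S t x)"
        proof (rule ccontr)
          assume "\<nexists>x. a * norm x < norm (S t x)"
          then have "norm (S t) \<le> a"
            using False by (intro norm_blinfun_bound) (auto simp: not_less)
          with \<open>a < norm (S t)\<close> show False by simp
        qed
      next
        assume "\<exists>x. a * norm x < norm (S t x)"
        then obtain x where "a * norm x < norm (S t x)" by blast
        also have "\<dots> \<le> norm (S t) * norm x" by (rule norm_blinfun)
        finally show "a < norm (S t)"
          by (rule mult_right_less_imp_less) simp
      qed
      with False show ?thesis by auto
    qed
    moreover have "open {t \<in> {0<..}. a * norm x < norm (S t x)}" for x
    proof -
      have "continuous_on {0<..} (\<lambda>t. norm (S t x))"
        using cont by (auto simp: strongly_continuous_def intro: continuous_on_norm)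
      then have "open ({0<..} \<inter> (\<lambda>t. norm (S t x)) -` {a * norm x<..})"
        by (intro continuous_open_preimage) auto
      moreover have "{0<..} \<inter> (\<lambda>t. norm (S t x)) -` {a * norm x<..}
          = {t \<in> {0<..}. a * norm x < norm (S t x)}" by auto
      ultimately show ?thesis by simp
    qed
    ultimately show ?thesis by auto
  qed
  have "{t \<in> {0<..1::real}. a < norm (S t)} \<in> sets lebesgue" for a
  proof -
    have "{t \<in> {0<..1::real}. a < norm (S t)} = {t \<in> {0<..}. a < norm (S t)} \<inter> {..1}"
      by auto
    also have "\<dots> \<in> sets borel"
      using lsc[of a] by (intro sets.Int) auto
    finally show ?thesis by (simp add: sets_completionI_sets)
  qed
  then have "(\<lambda>t. norm (S t)) \<in> borel_measurable (lebesgue_on {0<..1})"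
    by (auto simp: borel_measurable_iff_greater space_restrict_space sets_restrict_space_iff)
  then have "(\<lambda>t. norm (S t)) integrable_on {0<..1}"
  proof (rule measurable_bounded_by_integrable_imp_integrable)
    show "(\<lambda>t. M * exp \<bar>w\<bar>) integrable_on {0<..1::real}"
      by (intro integrable_on_const bounded_set_imp_lmeasurable) auto
    show "norm (norm (S t)) \<le> M * exp \<bar>w\<bar>" if "t \<in> {0<..1}" for t
    proof -
      have "w * t \<le> \<bar>w\<bar> * t"
        using that by (intro mult_right_mono) auto
      also have "\<dots> \<le> \<bar>w\<bar>"
        using that by (simp add: mult_left_le)
      finally have "M * exp (w * t) \<le> M * exp \<bar>w\<bar>"
        using \<open>M > 0\<close> by simp
      with bound[of t] that show ?thesis by simp
    qed
  qed auto
  with \<open>M > 0\<close> bound show ?thesis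
    unfolding exponentially_bounded_def
    by (intro conjI exI[of _ M] exI[of _ w]) auto
qed

text \<open>Vector-valued integrals are Henstock-Kurzweil integrals, since the library's Bochner
  integral needs a separable space. They agree with the Bochner integral on absolutely
  integrable functions and with the improper integral at \<open>0\<close> and \<open>\<infinity>\<close>.
  The power is the principal branch; only arguments in the open right half plane matter.\<close>

definition resolvent_family ::
  "real \<Rightarrow> real \<Rightarrow> 'a::complex_banach set \<Rightarrow> ('a \<Rightarrow> 'a) \<Rightarrow> (real \<Rightarrow> 'a \<Rightarrow>\<^sub>L 'a) \<Rightarrow> bool" where
  "resolvent_family \<alpha> \<beta> D A S \<longleftrightarrow>
     (\<forall>t>0. \<forall>c x. blinfun_apply (S t) (c *\<^sub>C x) = c *\<^sub>C blinfun_apply (S t) x) \<and>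
     strongly_continuous S \<and>
     exponentially_bounded S \<and>
     (\<exists>\<omega>\<ge>0. \<forall>l. Re l > \<omega> \<longrightarrow>
        l powr complex_of_real \<alpha> \<in> resolvent_set D A \<and>
        (\<forall>x. ((\<lambda>t. exp (- l * complex_of_real t) *\<^sub>C blinfun_apply (S t) x) has_integral
               l powr complex_of_real (\<alpha> - \<beta>) *\<^sub>C resolvent D A (l powr complex_of_real \<alpha>) x)
             {0<..}))"

definition g_kernel :: "real \<Rightarrow> real \<Rightarrow> real" where
  "g_kernel \<gamma> t = t powr (\<gamma> - 1) / Gamma \<gamma>"

text \<open>Finite convolution with respect to a product \<open>m\<close> (scalar multiplication or operator
  application). Convolutions of operator-valued functions are taken in the strong sense,
  i.e. pointwise in \<open>x\<close>; this is what strong continuity permits. Values at the single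
  point \<open>0\<close> do not influence the integral.\<close>

definition convolution ::
  "('b \<Rightarrow> 'c \<Rightarrow> 'a::real_normed_vector) \<Rightarrow> (real \<Rightarrow> 'b) \<Rightarrow> (real \<Rightarrow> 'c) \<Rightarrow> real \<Rightarrow> 'a" where
  "convolution m f h t = integral {0..t} (\<lambda>s. m (f (t - s)) (h s))"

definition convolution_exists ::
  "('b \<Rightarrow> 'c \<Rightarrow> 'a::real_normed_vector) \<Rightarrow> (real \<Rightarrow> 'b) \<Rightarrow> (real \<Rightarrow> 'c) \<Rightarrow> real \<Rightarrow> bool" where
  "convolution_exists m f h t \<longleftrightarrow> (\<lambda>s. m (f (t - s)) (h s)) integrable_on {0..t}"

definition op_convolution ::
  "('b \<Rightarrow> 'a \<Rightarrow> 'a::real_normed_vector) \<Rightarrow> (real \<Rightarrow> 'b) \<Rightarrow> (real \<Rightarrow> 'a \<Rightarrow> 'a) \<Rightarrow> real \<Rightarrow> 'a \<Rightarrow> 'a" where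
  "op_convolution m f F t x = convolution m f (\<lambda>s. F s x) t"

definition psi ::
  "('a \<Rightarrow> 'a) \<Rightarrow> (real \<Rightarrow> 'a::complex_banach \<Rightarrow>\<^sub>L 'a) \<Rightarrow> real \<Rightarrow> 'a \<Rightarrow> 'a" where
  "psi A S t x =
     A (op_convolution scaleR (g_kernel 2)
          (op_convolution blinfun_apply S (\<lambda>s. blinfun_apply (S s))) t x)
     + op_convolution scaleR (g_kernel 2) (\<lambda>s. blinfun_apply (S s)) t x"

end

(* Both sides of the identity have the same Laplace transform. Writing R l for the resolvent of A
   at l powr \<alpha>, the transform of u is R l x, that of S * u is (R l)^2 x, and differentiating
   R l x in l shows that t u(t) has transform \<alpha> l^(\<alpha>-1) (R l)^2 x, while
   A (R l)^2 + R l = l^\<alpha> (R l)^2. Uniqueness of the Laplace transform for vector-valued functions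
   follows from Weierstrass approximation. The unbounded operator A is removed by applying its
   resolvent R0 at one fixed point \<mu>, since w \<in> D and A w = y iff w = R0 (\<mu> w - y).
   Only real l are used. *)
theory Submission imports Defs begin

section \<open>Locally integrable functions on the half line\<close>

text \<open>The orbits may have an integrable singularity at 0, and \<open>S\<close> is only
  strongly continuous, so neither continuity up to 0 nor operator-norm integrals are available.
  Integrability of a singular vector-valued function is therefore certified by a primitive that is
  continuous up to the endpoints and differentiable inside; integration by parts, the double
  primitive and the local integrability of S * u all rest on this. The exchange of integrals behind
  the transform of S * u is carried out for a regularised kernel, with errors measured by the
  primitive of a scalar majorant of the operator norms. Since l^(\<alpha>-1) is l^\<alpha> / l,
  multiplying u by t amounts to \<alpha> times one integration of A (S * u) + u. One further
  integration gives the stated identity, because convolution with g_2 is a double primitive.\<close>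

lemma has_vector_derivative_of_increment:
  fixes f :: "real \<Rightarrow> 'a::banach"
  assumes cont: "continuous_on {a<..<b} f"
    and incr: "\<And>s t. a < s \<Longrightarrow> s \<le> t \<Longrightarrow> t < b \<Longrightarrow> F t - F s = integral {s..t} f"
    and t: "a < t" "t < b"
  shows "(F has_vector_derivative f t) (at t)"
proof -
  obtain p where p: "a < p" "p < t"
    using dense[OF t(1)] by blast
  obtain q where q: "t < q" "q < b"
    using dense[OF t(2)] by blast
  note pq = p q
  then have "continuous_on {p..q} f"
    by (intro continuous_on_subset[OF cont]) auto
  then have "((\<lambda>u. integral {p..u} f) has_vector_derivative f t) (at t within {p..q})"
    using pq by (intro integral_has_vector_derivative) auto
  then have "((\<lambda>u. F p + integral {p..u} f) has_vector_derivative f t) (at t within {p..q})"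
    using has_vector_derivative_add[OF has_vector_derivative_const[of "F p"]] by force
  moreover have "at t within {p..q} = at t"
    using pq by (intro at_within_interior) auto
  ultimately have D: "((\<lambda>u. F p + integral {p..u} f) has_vector_derivative f t) (at t)"
    by simp
  show ?thesis
  proof (rule has_vector_derivative_transform_within_open[OF D])
    show "F p + integral {p..u} f = F u" if "u \<in> {p<..<q}" for u
      using incr[of p u] pq that by (auto simp: algebra_simps)
  qed (use pq in auto)
qed

text \<open>The primitive \<open>F\<close> of \<open>f\<close> inside the interval moves no faster
  than the primitive \<open>H\<close> of \<open>h\<close>, which is uniformly continuous on the
  closed interval. So \<open>F\<close> extends continuously to both endpoints, and the fundamental
  theorem with interior derivatives yields the integral of \<open>f\<close>.\<close>

lemma integrable_dominated_interior:
  fixes f :: "real \<Rightarrow> 'a::banach"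
  assumes cont: "continuous_on {a<..<b} f"
    and h: "h integrable_on {a..b}"
    and le: "\<And>t. a < t \<Longrightarrow> t < b \<Longrightarrow> norm (f t) \<le> h t"
  shows "f integrable_on {a..b}"
proof (cases "a < b")
  case False
  then consider "b < a" | "a = b" by linarith
  then show ?thesis
    using integrable_on_refl[of f a] integrable_on_empty[of f] by cases auto
next
  case True
  define c where "c = (a + b) / 2"
  have c: "a < c" "c < b" using True by (auto simp: c_def)
  \<comment> \<open>A signed integral from the midpoint: for either order of \<open>c\<close> and
    \<open>t\<close> one of the two integrals is over an empty or degenerate interval. The base
    point is interior because \<open>f\<close> may be singular at both ends.\<close>
  define F where "F t = integral {c..t} f - integral {t..c} f" for t
  have fi: "f integrable_on {s..t}" if "a < s" "t < b" for s t
    using that by (intro integrable_continuous_real continuous_on_subset[OF cont]) auto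
  have incr: "F t - F s = integral {s..t} f" if st: "a < s" "s \<le> t" "t < b" for s t
  proof -
    consider "c \<le> s" | "t \<le> c" | "s < c" "c < t" by linarith
    then show ?thesis
    proof cases
      case 1
      then have "integral {c..s} f + integral {s..t} f = integral {c..t} f"
        using st c by (intro Henstock_Kurzweil_Integration.integral_combine fi) auto
      moreover have "integral {s..c} f = 0" "integral {t..c} f = 0"
        using 1 st by (cases "s = c"; cases "t = c"; simp)+
      ultimately show ?thesis by (simp add: F_def algebra_simps)
    next
      case 2
      then have "integral {s..t} f + integral {t..c} f = integral {s..c} f"
        using st c by (intro Henstock_Kurzweil_Integration.integral_combine fi) auto
      moreover have "integral {c..s} f = 0" "integral {c..t} f = 0"
        using 2 st by (cases "s = c"; cases "t = c"; simp)+
      ultimately show ?thesis by (simp add: F_def algebra_simps)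
    next
      case 3
      then have "integral {s..c} f + integral {c..t} f = integral {s..t} f"
        using st c by (intro Henstock_Kurzweil_Integration.integral_combine fi) auto
      with 3 show ?thesis by (simp add: F_def algebra_simps)
    qed
  qed
  define H where "H t = integral {a..t} h" for t
  have Hincr: "H t - H s = integral {s..t} h" if "a < s" "s \<le> t" "t < b" for s t
  proof -
    have "integral {a..s} h + integral {s..t} h = integral {a..t} h"
      using that by (intro Henstock_Kurzweil_Integration.integral_combine
          integrable_subinterval_real[OF h]) auto
    then show ?thesis by (simp add: H_def)
  qed
  have dF: "dist (F s) (F t) \<le> dist (H s) (H t)" if "s \<in> {a<..<b}" "t \<in> {a<..<b}" for s t
  proof -
    have *: "norm (F t - F s) \<le> norm (H t - H s)" if st: "a < s" "s \<le> t" "t < b" for s t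
    proof -
      have "norm (integral {s..t} f) \<le> integral {s..t} h"
        using st by (intro Henstock_Kurzweil_Integration.integral_norm_bound_integral fi
            integrable_subinterval_real[OF h] le) auto
      then show ?thesis using incr[OF st] Hincr[OF st] by auto
    qed
    show ?thesis
      using *[of s t] *[of t s] that by (cases "s \<le> t") (auto simp: dist_norm norm_minus_commute)
  qed
  have "uniformly_continuous_on {a..b} H"
    unfolding H_def using h by (intro compact_uniformly_continuous indefinite_integral_continuous_1) auto
  then have "uniformly_continuous_on {a<..<b} H"
    unfolding uniformly_continuous_on_def by (meson greaterThanLessThan_subseteq_atLeastAtMost_iff order_refl subsetD)
  then have ucF: "uniformly_continuous_on {a<..<b} F"
    unfolding uniformly_continuous_on_def by (meson dF le_less_trans)
  obtain g where g: "uniformly_continuous_on (closure {a<..<b}) g"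
      "\<And>x. x \<in> {a<..<b} \<Longrightarrow> F x = g x"
    using uniformly_continuous_on_extension_on_closure[OF ucF] by metis
  have "(f has_integral g b - g a) {a..b}"
  proof (rule fundamental_theorem_of_calculus_interior)
    show "continuous_on {a..b} g"
      using uniformly_continuous_imp_continuous[OF g(1)] True by simp
    show "(g has_vector_derivative f x) (at x)" if "x \<in> {a<..<b}" for x
      using that g(2)
      by (intro has_vector_derivative_transform_within_open[of F "f x" x "{a<..<b}" g]
          has_vector_derivative_of_increment[OF cont incr]) auto
  qed (use True in auto)
  then show ?thesis by (auto simp: integrable_on_def)
qed

text \<open>The shape of an orbit such as t powr (\<alpha> - 1): continuous except for an integrable
  singularity at 0. The value at 0 is immaterial.\<close>

definition cont_loc_integrable :: "(real \<Rightarrow> 'a::real_normed_vector) \<Rightarrow> bool" where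
  "cont_loc_integrable f \<longleftrightarrow> continuous_on {0<..} f \<and> (\<forall>T. f integrable_on {0..T})"

lemma cont_loc_integrableD: "cont_loc_integrable f \<Longrightarrow> f integrable_on {0..T}"
  by (simp add: cont_loc_integrable_def)

lemma cont_loc_integrable_if_continuous:
  fixes f :: "real \<Rightarrow> 'a::banach"
  assumes "continuous_on {0..} f"
  shows "cont_loc_integrable f"
  unfolding cont_loc_integrable_def
  by (intro conjI allI integrable_continuous_real continuous_on_subset[OF assms]) auto

text \<open>Continuity of \<open>F\<close> at 0 does the work of a size estimate for
  \<open>f\<close> near 0.\<close>

lemma cont_loc_integrableI_primitive:
  fixes f :: "real \<Rightarrow> 'a::banach"
  assumes cont: "continuous_on {0<..} f"
    and F: "continuous_on {0..} F" "\<And>t. 0 < t \<Longrightarrow> (F has_vector_derivative f t) (at t)"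
  shows "cont_loc_integrable f" and "0 \<le> T \<Longrightarrow> (f has_integral F T - F 0) {0..T}"
proof -
  show I: "(f has_integral F T - F 0) {0..T}" if "0 \<le> T" for T
    using that F by (intro fundamental_theorem_of_calculus_interior continuous_on_subset[OF F(1)]) auto
  have "f integrable_on {0..T}" for T
    by (cases "0 \<le> T") (use I[of T] in auto)
  with cont show "cont_loc_integrable f" by (simp add: cont_loc_integrable_def)
qed

lemma cont_loc_integrable_bounded_linear:
  assumes "bounded_linear h" "cont_loc_integrable f"
  shows "cont_loc_integrable (\<lambda>t. h (f t))"
  using bounded_linear.continuous_on[OF assms(1)] integrable_linear[OF _ assms(1)] assms(2)
  unfolding cont_loc_integrable_def o_def by blast

lemma cont_loc_integrable_add:
  "cont_loc_integrable f \<Longrightarrow> cont_loc_integrable g \<Longrightarrow> cont_loc_integrable (\<lambda>t. f t + g t)"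
  unfolding cont_loc_integrable_def using continuous_on_add integrable_add by blast

lemma cont_loc_integrable_diff:
  "cont_loc_integrable f \<Longrightarrow> cont_loc_integrable g \<Longrightarrow> cont_loc_integrable (\<lambda>t. f t - g t)"
  unfolding cont_loc_integrable_def using continuous_on_diff integrable_diff by blast

lemma continuous_on_atLeastI:
  fixes f :: "real \<Rightarrow> 'a::topological_space"
  assumes "\<And>T. 0 < T \<Longrightarrow> continuous_on {0..T} f"
  shows "continuous_on {0..} f"
  unfolding continuous_on_eq_continuous_within
proof
  fix t :: real assume t: "t \<in> {0..}"
  have "continuous (at t within {0..t+1}) f"
    using assms[of "t+1"] t by (auto simp: continuous_on_eq_continuous_within)
  moreover have "at t within {0..t+1} = at t within {0..}"
    using t by (intro at_within_nhd[of _ "{..<t+1}"]) auto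
  ultimately show "continuous (at t within {0..}) f" by (simp add: continuous_within)
qed

lemma primitive:
  fixes f :: "real \<Rightarrow> 'a::banach"
  assumes f: "cont_loc_integrable f"
  shows primitive_continuous: "continuous_on {0..} (\<lambda>t. integral {0..t} f)"
    and primitive_derivative:
      "0 < t \<Longrightarrow> ((\<lambda>t. integral {0..t} f) has_vector_derivative f t) (at t)"
    and primitive_cont_loc_integrable: "cont_loc_integrable (\<lambda>t. integral {0..t} f)"
proof -
  have fi: "f integrable_on {0..T}" for T using f by (simp add: cont_loc_integrable_def)
  show C: "continuous_on {0..} (\<lambda>t. integral {0..t} f)"
    by (intro continuous_on_atLeastI indefinite_integral_continuous_1 fi)
  then show "cont_loc_integrable (\<lambda>t. integral {0..t} f)"
    by (rule cont_loc_integrable_if_continuous)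
  show "((\<lambda>t. integral {0..t} f) has_vector_derivative f t) (at t)" if "0 < t"
  proof (rule has_vector_derivative_of_increment)
    show "continuous_on {0<..<t+1} f"
      using f unfolding cont_loc_integrable_def
      by (intro continuous_on_subset[of "{0<..}" f "{0<..<t+1}"]) auto
    show "integral {0..q} f - integral {0..p} f = integral {p..q} f" if "0 < p" "p \<le> q" for p q
      using Henstock_Kurzweil_Integration.integral_combine[of 0 p q f] fi that
      by (simp add: algebra_simps)
  qed (use that in auto)
qed

text \<open>Both claims come from one primitive: by the product rule \<open>G\<close> has derivative
  exp (c t) f(t) on the open half line, and it is continuous at 0. Integrability of the product and
  integration by parts are thus obtained together.\<close>

lemma integral_exp_times:
  fixes f :: "real \<Rightarrow> 'a::banach"
  assumes f: "cont_loc_integrable f"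
  defines "F \<equiv> \<lambda>t. integral {0..t} f"
  shows cont_loc_integrable_exp: "cont_loc_integrable (\<lambda>t. exp (c * t) *\<^sub>R f t)"
    and integral_exp_parts: "0 \<le> N \<Longrightarrow> integral {0..N} (\<lambda>t. exp (c * t) *\<^sub>R f t) =
        exp (c * N) *\<^sub>R F N - c *\<^sub>R integral {0..N} (\<lambda>t. exp (c * t) *\<^sub>R F t)"
proof -
  define E where "E t = exp (c * t) *\<^sub>R F t" for t
  define G where "G t = E t - c *\<^sub>R integral {0..t} E" for t
  have contF: "continuous_on {0..} F"
    unfolding F_def by (rule primitive_continuous[OF f])
  have contE: "continuous_on {0..} E"
    unfolding E_def by (intro continuous_intros contF)
  then have E: "cont_loc_integrable E"
    by (rule cont_loc_integrable_if_continuous)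
  have cG: "continuous_on {0..} G"
    unfolding G_def by (intro continuous_intros contE primitive_continuous E)
  have dG: "(G has_vector_derivative exp (c * t) *\<^sub>R f t) (at t)" if "0 < t" for t
  proof -
    have "((\<lambda>t. exp (c * t)) has_vector_derivative c * exp (c * t)) (at t)"
      by (auto intro!: derivative_eq_intros simp: has_real_derivative_iff_has_vector_derivative[symmetric])
    then have "(E has_vector_derivative exp (c * t) *\<^sub>R f t + (c * exp (c * t)) *\<^sub>R F t) (at t)"
      unfolding E_def F_def
      by (intro has_vector_derivative_scaleR primitive_derivative[OF f that])
        (simp add: has_real_derivative_iff_has_vector_derivative)
    moreover have "((\<lambda>t. c *\<^sub>R integral {0..t} E) has_vector_derivative c *\<^sub>R E t) (at t)"
      by (intro bounded_linear.has_vector_derivative[OF bounded_linear_scaleR_right]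
          primitive_derivative[OF E that])
    ultimately have "(G has_vector_derivative
        exp (c * t) *\<^sub>R f t + (c * exp (c * t)) *\<^sub>R F t - c *\<^sub>R E t) (at t)"
      unfolding G_def by (rule has_vector_derivative_diff)
    then show ?thesis by (simp add: E_def)
  qed
  have "continuous_on {0<..} (\<lambda>t. exp (c * t) *\<^sub>R f t)"
    using f by (auto simp: cont_loc_integrable_def intro!: continuous_intros)
  note * = cont_loc_integrableI_primitive[OF this cG dG]
  show "cont_loc_integrable (\<lambda>t. exp (c * t) *\<^sub>R f t)" using *(1) by simp
  have "E 0 = 0" by (simp add: E_def F_def)
  then have "G 0 = 0" by (simp add: G_def)
  then show "integral {0..N} (\<lambda>t. exp (c * t) *\<^sub>R f t) =
        exp (c * N) *\<^sub>R F N - c *\<^sub>R integral {0..N} (\<lambda>t. exp (c * t) *\<^sub>R F t)" if "0 \<le> N"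
    using integral_unique[OF *(2)[OF _ that]] by (simp add: G_def E_def[abs_def])
qed

lemma primitive_zero_imp_zero:
  fixes f :: "real \<Rightarrow> 'a::banach"
  assumes "cont_loc_integrable f" "\<And>t. 0 < t \<Longrightarrow> t < b \<Longrightarrow> integral {0..t} f = 0" and "0 < t" "t < b"
  shows "f t = 0"
proof -
  have "((\<lambda>t. integral {0..t} f) has_vector_derivative 0) (at t)"
    using assms
    by (intro has_vector_derivative_transform_within_open
        [where S = "{0<..<b}", OF has_vector_derivative_const]) auto
  with primitive_derivative[OF assms(1,3)] show ?thesis
    using vector_derivative_unique_at by blast
qed

text \<open>Cauchy's formula for repeated integration; the weight T - s is the kernel g_2 (T - s).
  By the product rule \<open>G\<close> is a primitive of the weighted function, with G(0) = 0 and
  G(T) equal to the double integral.\<close>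

lemma integral_primitive:
  fixes f :: "real \<Rightarrow> 'a::banach"
  assumes f: "cont_loc_integrable f" and "0 \<le> T"
  shows "((\<lambda>s. (T - s) *\<^sub>R f s) has_integral integral {0..T} (\<lambda>t. integral {0..t} f)) {0..T}"
proof -
  define F where "F t = integral {0..t} f" for t
  define G where "G t = integral {0..t} F + (T - t) *\<^sub>R F t" for t
  have contF: "continuous_on {0..} F" and F: "cont_loc_integrable F"
    unfolding F_def by (intro primitive[OF f])+
  have cG: "continuous_on {0..} G"
    unfolding G_def by (intro continuous_intros contF primitive_continuous F)
  have dG: "(G has_vector_derivative (T - t) *\<^sub>R f t) (at t)" if "0 < t" for t
  proof -
    have 1: "((\<lambda>t. T - t) has_real_derivative -1) (at t)"
      by (auto intro!: derivative_eq_intros)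
    have "((\<lambda>t. (T - t) *\<^sub>R F t) has_vector_derivative (T - t) *\<^sub>R f t + (-1) *\<^sub>R F t) (at t)"
      using has_vector_derivative_scaleR[OF 1, of F "f t"] primitive_derivative[OF f that]
      by (simp add: F_def[abs_def])
    then have "(G has_vector_derivative (F t + ((T - t) *\<^sub>R f t + (-1) *\<^sub>R F t))) (at t)"
      unfolding G_def by (intro has_vector_derivative_add primitive_derivative[OF F that])
    then show ?thesis by simp
  qed
  have "((\<lambda>t. (T - t) *\<^sub>R f t) has_integral G T - G 0) {0..T}"
    using f by (intro cont_loc_integrableI_primitive(2)[OF _ cG dG] \<open>0 \<le> T\<close>)
      (auto simp: cont_loc_integrable_def intro!: continuous_intros)
  then show ?thesis by (simp add: G_def F_def[abs_def])
qed

section \<open>Uniqueness of the Laplace transform\<close>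

text \<open>Weierstrass approximation is applied to the scalar weight \<phi> only; the vector-valued
  \<open>h\<close> enters through its bound \<open>B\<close>, whence the tolerance e / B.\<close>

lemma integral_continuous_times_zero:
  fixes h :: "real \<Rightarrow> 'a::banach"
  assumes h: "continuous_on {0..1} h"
    and mom: "\<And>n. integral {0..1} (\<lambda>s. s ^ n *\<^sub>R h s) = 0"
    and \<phi>: "continuous_on {0..1} \<phi>"
  shows "integral {0..1} (\<lambda>s. \<phi> s *\<^sub>R h s) = 0"
proof -
  have "bounded (h ` {0..1})"
    by (intro compact_imp_bounded compact_continuous_image h) simp
  then obtain B where B: "\<And>s. s \<in> {0..1} \<Longrightarrow> norm (h s) \<le> B" "0 < B"
    unfolding bounded_pos by blast
  have "norm (integral {0..1} (\<lambda>s. \<phi> s *\<^sub>R h s)) \<le> e" if "0 < e" for e :: real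
  proof -
    obtain p where p: "real_polynomial_function p"
        "\<And>s. s \<in> {0..1} \<Longrightarrow> \<bar>\<phi> s - p s\<bar> < e / B"
      using Stone_Weierstrass_real_polynomial_function[of "{0..1}" \<phi> "e / B"] \<phi> \<open>0 < e\<close> B(2)
      by auto
    obtain a n where an: "p = (\<lambda>x. \<Sum>i\<le>n. a i * x ^ i)"
      using p(1) real_polynomial_function_iff_sum by blast
    have contp: "continuous_on {0..1} p"
      unfolding an by (intro continuous_intros)
    have I: "(\<lambda>s. a i *\<^sub>R (s ^ i *\<^sub>R h s)) integrable_on {0..1}" for i
      by (intro integrable_continuous_real continuous_intros h)
    have "integral {0..1} (\<lambda>s. p s *\<^sub>R h s) = integral {0..1} (\<lambda>s. \<Sum>i\<le>n. a i *\<^sub>R (s ^ i *\<^sub>R h s))"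
      by (simp add: an scaleR_sum_left)
    also have "\<dots> = (\<Sum>i\<le>n. integral {0..1} (\<lambda>s. a i *\<^sub>R (s ^ i *\<^sub>R h s)))"
      by (intro integral_sum I) auto
    also have "\<dots> = 0" by (simp only: integral_cmul mom) simp
    finally have 0: "integral {0..1} (\<lambda>s. p s *\<^sub>R h s) = 0" .
    have "integral {0..1} (\<lambda>s. (\<phi> s - p s) *\<^sub>R h s)
        = integral {0..1} (\<lambda>s. \<phi> s *\<^sub>R h s) - integral {0..1} (\<lambda>s. p s *\<^sub>R h s)"
      unfolding scaleR_diff_left
      by (intro Henstock_Kurzweil_Integration.integral_diff integrable_continuous_real
          continuous_intros h \<phi> contp)
    then have "integral {0..1} (\<lambda>s. \<phi> s *\<^sub>R h s) = integral {0..1} (\<lambda>s. (\<phi> s - p s) *\<^sub>R h s)"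
      using 0 by simp
    also have "norm \<dots> \<le> e * (1 - 0)"
    proof (rule integral_bound)
      show "continuous_on {0..1} (\<lambda>s. (\<phi> s - p s) *\<^sub>R h s)"
        by (intro continuous_intros h \<phi> contp)
      show "norm ((\<phi> s - p s) *\<^sub>R h s) \<le> e" if "s \<in> {0..1}" for s
      proof -
        have "\<bar>\<phi> s - p s\<bar> * norm (h s) \<le> (e / B) * B"
          using p(2)[OF that] B(1)[OF that] \<open>0 < e\<close> B(2) by (intro mult_mono) auto
        then show ?thesis using B(2) by simp
      qed
    qed simp
    finally show ?thesis by simp
  qed
  then show ?thesis
    using field_le_epsilon[of "norm (integral {0..1} (\<lambda>s. \<phi> s *\<^sub>R h s))" 0] by auto
qed

text \<open>The test weights are the ramps max 0 (c - s). Against them \<open>h\<close> integrates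
  to its double primitive at \<open>c\<close>, so this vanishes for every \<open>c\<close> in (0,1),
  and differentiating twice gives h = 0.\<close>

lemma moments_zero_imp_zero:
  fixes h :: "real \<Rightarrow> 'a::banach"
  assumes h: "continuous_on {0..} h"
    and mom: "\<And>n. integral {0..1} (\<lambda>s. s ^ n *\<^sub>R h s) = 0"
    and s: "0 < s" "s < 1"
  shows "h s = 0"
proof -
  have hc: "cont_loc_integrable h"
    using h by (rule cont_loc_integrable_if_continuous)
  have zero: "integral {0..c} (\<lambda>t. integral {0..t} h) = 0" if c: "0 < c" "c < 1" for c
  proof -
    define k where "k s = max 0 (c - s) *\<^sub>R h s" for s
    have contk: "continuous_on {0..} k"
      unfolding k_def by (intro continuous_intros h)
    have "integral {0..c} k + integral {c..1} k = integral {0..1} k"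
      using c by (intro Henstock_Kurzweil_Integration.integral_combine integrable_continuous_real
          continuous_on_subset[OF contk]) auto
    moreover have "integral {0..1} k = 0"
      unfolding k_def
    proof (rule integral_continuous_times_zero[OF _ mom])
      show "continuous_on {0..1} h" by (rule continuous_on_subset[OF h]) auto
    qed (intro continuous_intros)
    moreover have "integral {c..1} k = integral {c..1} (\<lambda>_. 0)"
      by (intro integral_cong) (auto simp: k_def)
    moreover have "integral {0..c} k = integral {0..c} (\<lambda>s. (c - s) *\<^sub>R h s)"
      by (intro integral_cong) (auto simp: k_def)
    moreover have "\<dots> = integral {0..c} (\<lambda>t. integral {0..t} h)"
      using c by (intro integral_unique integral_primitive hc) auto
    ultimately show ?thesis by simp
  qed
  have "integral {0..t} h = 0" if "0 < t" "t < 1" for t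
    using primitive_zero_imp_zero[OF primitive_cont_loc_integrable[OF hc] zero that] .
  then show ?thesis
    using primitive_zero_imp_zero[OF hc _ s] by blast
qed

text \<open>Under t = - ln s the point s = 0 corresponds to t = \<infinity>, so the value there is
  the limit 0 of \<open>G\<close>. The \<open>max 0\<close> freezes the argument at 0 for s > 1,
  which makes the function continuous on all of {0..}.\<close>

lemma continuous_on_ln_substitution:
  fixes G :: "real \<Rightarrow> 'a::real_normed_vector"
  assumes G: "continuous_on {0..} G" and lim: "(G \<longlongrightarrow> 0) at_top"
  shows "continuous_on {0..} (\<lambda>s. if s \<le> 0 then 0 else G (max 0 (- ln s)))"
    (is "continuous_on _ ?h")
  unfolding continuous_on_eq_continuous_within
proof
  fix s :: real assume "s \<in> {0..}"
  then consider "s = 0" | "0 < s" by fastforce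
  then show "continuous (at s within {0..}) ?h"
  proof cases
    case 1
    have "filterlim (\<lambda>s::real. - ln s) at_top (at_right 0)"
      using ln_at_0 by (simp add: filterlim_uminus_at_bot)
    then have "filterlim (\<lambda>s::real. max 0 (- ln s)) at_top (at_right 0)"
      by (rule filterlim_at_top_mono) simp
    then have "((\<lambda>s. G (max 0 (- ln s))) \<longlongrightarrow> 0) (at_right 0)"
      by (rule filterlim_compose[OF lim])
    then have "(?h \<longlongrightarrow> 0) (at_right 0)"
      by (rule Lim_transform_eventually)
        (use eventually_at_right_less[of 0] in \<open>auto elim: eventually_mono\<close>)
    moreover have "at (0::real) within {0..} = at_right 0"
      by (intro at_within_nhd[of _ "UNIV"]) auto
    ultimately show ?thesis using 1 by (simp add: continuous_within)
  next
    case 2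
    have "continuous_on {0<..} (\<lambda>s::real. G (max 0 (- ln s)))"
      by (intro continuous_on_compose2[OF G] continuous_intros) auto
    then have "continuous_on {0<..} ?h"
      by (rule continuous_on_eq) auto
    then have "isCont ?h s" using 2 by (simp add: continuous_on_eq_continuous_at)
    then show ?thesis by (rule continuous_at_imp_continuous_at_within)
  qed
qed

text \<open>An improper limit stated as a relation, so that convergence is part of the claim; the
  convergence at infinity may be conditional.\<close>

definition laplace_to :: "(real \<Rightarrow> 'a::real_normed_vector) \<Rightarrow> real \<Rightarrow> 'a \<Rightarrow> bool" where
  "laplace_to f l y \<longleftrightarrow> ((\<lambda>N. integral {0..N} (\<lambda>t. exp (- l * t) *\<^sub>R f t)) \<longlongrightarrow> y) at_top"

lemma laplace_to_bounded_linear: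
  fixes f :: "real \<Rightarrow> 'a::banach"
  assumes h: "bounded_linear h" and f: "cont_loc_integrable f" and "laplace_to f l y"
  shows "laplace_to (\<lambda>t. h (f t)) l (h y)"
proof -
  have "integral {0..N} (\<lambda>t. exp (- l * t) *\<^sub>R h (f t)) = h (integral {0..N} (\<lambda>t. exp (- l * t) *\<^sub>R f t))" for N
    using integral_linear[OF _ h, of "\<lambda>t. exp (- l * t) *\<^sub>R f t" "{0..N}"]
      cont_loc_integrable_exp[OF f, of "-l"]
    by (simp add: cont_loc_integrable_def o_def linear_simps(5)[OF h])
  then show ?thesis
    using assms(3) bounded_linear.tendsto[OF h] by (simp add: laplace_to_def)
qed

lemma laplace_to_add:
  fixes f g :: "real \<Rightarrow> 'a::banach"
  assumes "cont_loc_integrable f" "cont_loc_integrable g" "laplace_to f l y" "laplace_to g l z"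
  shows "laplace_to (\<lambda>t. f t + g t) l (y + z)"
proof -
  have "integral {0..N} (\<lambda>t. exp (- l * t) *\<^sub>R (f t + g t)) =
      integral {0..N} (\<lambda>t. exp (- l * t) *\<^sub>R f t) + integral {0..N} (\<lambda>t. exp (- l * t) *\<^sub>R g t)" for N
    using cont_loc_integrable_exp[OF assms(1), of "-l"] cont_loc_integrable_exp[OF assms(2), of "-l"]
    by (simp add: cont_loc_integrable_def scaleR_add_right Henstock_Kurzweil_Integration.integral_add)
  then show ?thesis
    using tendsto_add assms(3,4) by (simp add: laplace_to_def)
qed

lemma laplace_to_diff:
  fixes f g :: "real \<Rightarrow> 'a::banach"
  assumes "cont_loc_integrable f" "cont_loc_integrable g" "laplace_to f l y" "laplace_to g l z"
  shows "laplace_to (\<lambda>t. f t - g t) l (y - z)"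
proof -
  have "integral {0..N} (\<lambda>t. exp (- l * t) *\<^sub>R (f t - g t)) =
      integral {0..N} (\<lambda>t. exp (- l * t) *\<^sub>R f t) - integral {0..N} (\<lambda>t. exp (- l * t) *\<^sub>R g t)" for N
    using cont_loc_integrable_exp[OF assms(1), of "-l"] cont_loc_integrable_exp[OF assms(2), of "-l"]
    by (simp add: cont_loc_integrable_def scaleR_diff_right Henstock_Kurzweil_Integration.integral_diff)
  then show ?thesis
    using tendsto_diff assms(3,4) by (simp add: laplace_to_def)
qed

lemma bounded_if_tendsto_at_top:
  fixes H :: "real \<Rightarrow> 'a::real_normed_vector"
  assumes "continuous_on {0..} H" "(H \<longlongrightarrow> y) at_top"
  obtains C where "0 < C" "\<And>t. 0 \<le> t \<Longrightarrow> norm (H t) \<le> C"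
proof -
  have "\<forall>\<^sub>F t in at_top. dist (H t) y < 1"
    using assms(2) by (rule tendstoD) simp
  then obtain N where N: "\<And>t. N \<le> t \<Longrightarrow> dist (H t) y < 1"
    by (auto simp: eventually_at_top_linorder)
  have "bounded (H ` {0..N})"
    by (intro compact_imp_bounded compact_continuous_image continuous_on_subset[OF assms(1)]) auto
  then obtain B where B: "0 < B" "\<And>t. t \<in> {0..N} \<Longrightarrow> norm (H t) \<le> B"
    by (auto simp: bounded_pos)
  show thesis
  proof (rule that[of "B + (norm y + 1)"])
    show "norm (H t) \<le> B + (norm y + 1)" if "0 \<le> t" for t
    proof (cases "t \<le> N")
      case True
      then show ?thesis using B(2)[of t] that by (auto intro: order_trans)
    next
      case False
      then have "norm (H t - y) < 1" using N[of t] by (simp add: dist_norm)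
      then show ?thesis using B(1) norm_triangle_sub[of "H t" y] by simp
    qed
  qed (use B in \<open>auto intro: add_pos_nonneg\<close>)
qed

text \<open>Integration by parts leaves the boundary term exp (- l N) F(N). Convergence at the
  smaller \<open>l'\<close> bounds \<open>H\<close>; writing f = exp (l' t) q and integrating by
  parts again, \<open>F\<close> grows at most like (C + l' C N) exp (l' N), which exp (- l N)
  beats.\<close>

lemma laplace_to_primitive:
  fixes f :: "real \<Rightarrow> 'a::banach"
  assumes f: "cont_loc_integrable f" and l: "0 \<le> l'" "l' < l"
    and "laplace_to f l' y'" and y: "laplace_to f l y"
  shows "laplace_to (\<lambda>t. integral {0..t} f) l (y /\<^sub>R l)"
proof -
  define F where "F t = integral {0..t} f" for t
  define q where "q t = exp (- l' * t) *\<^sub>R f t" for t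
  define H where "H t = integral {0..t} q" for t
  have q: "cont_loc_integrable q"
    unfolding q_def by (rule cont_loc_integrable_exp[OF f])
  have contH: "continuous_on {0..} H"
    unfolding H_def by (rule primitive_continuous[OF q])
  have "(H \<longlongrightarrow> y') at_top"
    using assms(4) by (simp add: H_def[abs_def] laplace_to_def q_def[abs_def])
  then obtain C where C: "0 < C" "\<And>t. 0 \<le> t \<Longrightarrow> norm (H t) \<le> C"
    using bounded_if_tendsto_at_top[OF contH] by blast
  have F_bound: "norm (F N) \<le> (C + l' * C * N) * exp (l' * N)" if N: "0 \<le> N" for N
  proof -
    have "F N = integral {0..N} (\<lambda>t. exp (l' * t) *\<^sub>R q t)"
      by (simp add: F_def q_def exp_minus)
    also have "\<dots> = exp (l' * N) *\<^sub>R H N - l' *\<^sub>R integral {0..N} (\<lambda>t. exp (l' * t) *\<^sub>R H t)"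
      unfolding H_def by (rule integral_exp_parts[OF q N])
    also have "norm \<dots> \<le> exp (l' * N) * C + l' * ((exp (l' * N) * C) * (N - 0))"
    proof (rule order_trans[OF norm_triangle_ineq4 add_mono])
      show "norm (exp (l' * N) *\<^sub>R H N) \<le> exp (l' * N) * C"
        using C(2)[OF N] by simp
      have "norm (integral {0..N} (\<lambda>t. exp (l' * t) *\<^sub>R H t)) \<le> (exp (l' * N) * C) * (N - 0)"
      proof (rule integral_bound[OF N])
        show "continuous_on {0..N} (\<lambda>t. exp (l' * t) *\<^sub>R H t)"
          by (intro continuous_intros continuous_on_subset[OF contH]) auto
        show "norm (exp (l' * t) *\<^sub>R H t) \<le> exp (l' * N) * C" if "t \<in> {0..N}" for t
          using C(2)[of t] C(1) that l(1) by (auto intro!: mult_mono mult_left_mono)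
      qed
      then show "norm (l' *\<^sub>R integral {0..N} (\<lambda>t. exp (l' * t) *\<^sub>R H t))
          \<le> l' * ((exp (l' * N) * C) * (N - 0))"
        using l(1) by (simp add: mult_left_mono)
    qed
    finally show ?thesis by (simp add: algebra_simps)
  qed
  have "((\<lambda>N. exp (- l * N) *\<^sub>R F N) \<longlongrightarrow> 0) at_top"
  proof (rule Lim_null_comparison)
    show "\<forall>\<^sub>F N in at_top. norm (exp (- l * N) *\<^sub>R F N) \<le> (C + l' * C * N) * exp (- (l - l') * N)"
      unfolding eventually_at_top_linorder
    proof (intro exI[of _ 0] allI impI)
      fix N :: real assume "0 \<le> N"
      have "norm (exp (- l * N) *\<^sub>R F N) \<le> exp (- l * N) * ((C + l' * C * N) * exp (l' * N))"
        using F_bound[OF \<open>0 \<le> N\<close>] by simp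
      also have "\<dots> = (C + l' * C * N) * (exp (- l * N) * exp (l' * N))"
        by (simp add: mult_ac)
      finally show "norm (exp (- l * N) *\<^sub>R F N) \<le> (C + l' * C * N) * exp (- (l - l') * N)"
        by (simp add: exp_add[symmetric] algebra_simps)
    qed
    define d where "d = l - l'"
    have "d > 0" using l by (simp add: d_def)
    then have "((\<lambda>N. (C + l' * C * N) * exp (- d * N)) \<longlongrightarrow> 0) at_top"
      by real_asymp
    then show "((\<lambda>N. (C + l' * C * N) * exp (- (l - l') * N)) \<longlongrightarrow> 0) at_top"
      by (simp add: d_def)
  qed
  then have "((\<lambda>N. (integral {0..N} (\<lambda>t. exp (- l * t) *\<^sub>R f t) - exp (- l * N) *\<^sub>R F N) /\<^sub>R l)
      \<longlongrightarrow> (y - 0) /\<^sub>R l) at_top"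
    using y unfolding laplace_to_def by (intro tendsto_intros)
  moreover have "\<forall>\<^sub>F N in at_top. (integral {0..N} (\<lambda>t. exp (- l * t) *\<^sub>R f t) - exp (- l * N) *\<^sub>R F N) /\<^sub>R l
      = integral {0..N} (\<lambda>t. exp (- l * t) *\<^sub>R F t)"
    unfolding eventually_at_top_linorder F_def
    using integral_exp_parts[OF f, of _ "-l"] l by (intro exI[of _ 0]) (simp add: F_def)
  ultimately show ?thesis
    unfolding laplace_to_def F_def by (simp add: Lim_transform_eventually)
qed

text \<open>The substitution \<open>s = exp (- t)\<close> turns the Laplace transform at \<open>l + n\<close> into the
  \<open>n\<close>-th moment on \<open>[0,1]\<close>.\<close>

theorem lerch:
  fixes f :: "real \<Rightarrow> 'a::banach"
  assumes f: "cont_loc_integrable f" and L: "\<And>n::nat. laplace_to f (l + n) 0" and "0 < t"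
  shows "f t = 0"
proof -
  define q where "q t = exp (- l * t) *\<^sub>R f t" for t
  \<comment> \<open>Moments are taken of the primitive \<open>G\<close>, not of \<open>q\<close>: it
    is continuous at 0, and the hypothesis at n = 0 makes it tend to 0 at infinity, so it stays
    continuous on [0,1] after the substitution.\<close>
  define G where "G t = integral {0..t} q" for t
  \<comment> \<open>The exponent is n + 1 because ds = - exp (- t) dt supplies one factor of s next
    to s ^ n.\<close>
  define M where "M n N = integral {0..N} (\<lambda>t. exp (- real (Suc n) * t) *\<^sub>R G t)" for n N
  have q: "cont_loc_integrable q"
    unfolding q_def by (rule cont_loc_integrable_exp[OF f])
  have contG: "continuous_on {0..} G" and dG: "cont_loc_integrable G"
    unfolding G_def by (intro primitive[OF q])+
  have limG: "(G \<longlongrightarrow> 0) at_top"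
    using L[of 0] by (simp add: laplace_to_def G_def[abs_def] q_def[abs_def])
  have eG: "cont_loc_integrable (\<lambda>t. exp (- real (Suc n) * t) *\<^sub>R G t)" for n
    by (rule cont_loc_integrable_exp[OF dG])
  have contM: "continuous_on {0..} (M n)" for n
    unfolding M_def[abs_def] by (rule primitive_continuous[OF eG])
  \<comment> \<open>Integration by parts expresses \<open>M n N\<close> through the truncated
    transform of \<open>f\<close> at l + (n + 1) and a boundary term; both tend to 0.\<close>
  have limM: "(M n \<longlongrightarrow> 0) at_top" for n
  proof -
    define c where "c = real (Suc n)"
    have "c > 0" by (simp add: c_def)
    then have "((\<lambda>N. exp (- c * N)) \<longlongrightarrow> 0) at_top" by real_asymp
    then have "((\<lambda>N. (integral {0..N} (\<lambda>t. exp (- (l + real (Suc n)) * t) *\<^sub>R f t) - exp (- c * N) *\<^sub>R G N) /\<^sub>R c)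
      \<longlongrightarrow> (0 - 0 *\<^sub>R 0) /\<^sub>R c) at_top"
      using L[of "Suc n"] limG unfolding laplace_to_def by (intro tendsto_intros)
    moreover have "\<forall>\<^sub>F N in at_top.
        (integral {0..N} (\<lambda>t. exp (- (l + real (Suc n)) * t) *\<^sub>R f t) - exp (- c * N) *\<^sub>R G N) /\<^sub>R c = M n N"
      unfolding eventually_at_top_linorder
    proof (intro exI[of _ 0] allI impI)
      fix N :: real assume "0 \<le> N"
      have "integral {0..N} (\<lambda>t. exp (- (l + real (Suc n)) * t) *\<^sub>R f t)
          = integral {0..N} (\<lambda>t. exp ((- c) * t) *\<^sub>R q t)"
        by (simp add: q_def c_def exp_add[symmetric] algebra_simps)
      also have "\<dots> = exp (- c * N) *\<^sub>R G N - (- c) *\<^sub>R M n N"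
        using integral_exp_parts[OF q \<open>0 \<le> N\<close>, of "-c"] by (simp add: G_def M_def c_def)
      finally show "(integral {0..N} (\<lambda>t. exp (- (l + real (Suc n)) * t) *\<^sub>R f t) - exp (- c * N) *\<^sub>R G N) /\<^sub>R c = M n N"
        using \<open>c > 0\<close> by simp
    qed
    ultimately show ?thesis by (simp add: Lim_transform_eventually)
  qed
  define h where "h s = (if s \<le> 0 then 0 else G (max 0 (- ln s)))" for s
  \<comment> \<open>A primitive of - s ^ n h(s) on (0,1) that vanishes at both ends: at s = 1
    because t = 0 there, at s = 0 by the limit of \<open>M n\<close>. The fundamental theorem thus
    replaces a change of variables.\<close>
  define K where "K n s = (if s \<le> 0 then 0 else M n (max 0 (- ln s)))" for n s
  have contK: "continuous_on {0..} (K n)" for n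
    unfolding K_def by (rule continuous_on_ln_substitution[OF contM limM])
  have mom: "integral {0..1} (\<lambda>s. s ^ n *\<^sub>R h s) = 0" for n
  proof -
    have dK: "(K n has_vector_derivative - (s ^ n *\<^sub>R h s)) (at s)" if s: "s \<in> {0<..<1}" for s
    proof -
      have "((\<lambda>s. - ln s) has_real_derivative - (1 / s)) (at s)"
        using s by (auto intro!: derivative_eq_intros)
      then have 1: "((\<lambda>s. - ln s) has_vector_derivative - (1 / s)) (at s)"
        by (simp add: has_real_derivative_iff_has_vector_derivative)
      have 2: "(M n has_vector_derivative exp (- real (Suc n) * (- ln s)) *\<^sub>R G (- ln s)) (at (- ln s))"
        unfolding M_def[abs_def] using s by (intro primitive_derivative[OF eG]) simp
      have "(M n \<circ> (\<lambda>s. - ln s) has_vector_derivative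
          (- (1 / s)) *\<^sub>R (exp (- real (Suc n) * (- ln s)) *\<^sub>R G (- ln s))) (at s)"
        using 1 2 by (rule vector_diff_chain_at)
      moreover have "exp (- real (Suc n) * (- ln s)) = s ^ Suc n"
        using s by (simp only: minus_mult_minus exp_of_nat_mult) simp
      then have "(- (1 / s)) *\<^sub>R (exp (- real (Suc n) * (- ln s)) *\<^sub>R G (- ln s)) = - (s ^ n *\<^sub>R h s)"
        using s by (simp add: h_def)
      ultimately have "(M n \<circ> (\<lambda>s. - ln s) has_vector_derivative - (s ^ n *\<^sub>R h s)) (at s)"
        by simp
      then show ?thesis
        by (rule has_vector_derivative_transform_within_open[of _ _ _ "{0<..<1}"])
          (use s in \<open>auto simp: K_def\<close>)
    qed
    have "((\<lambda>s. - (s ^ n *\<^sub>R h s)) has_integral K n 1 - K n 0) {0..1}"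
      using dK by (intro fundamental_theorem_of_calculus_interior continuous_on_subset[OF contK]) auto
    from integral_unique[OF this] show ?thesis by (simp add: K_def M_def)
  qed
  have "G t = 0" if "0 < t" for t
  proof -
    have "h (exp (- t)) = 0"
    proof (rule moments_zero_imp_zero[OF _ mom])
      show "continuous_on {0..} h"
        unfolding h_def by (rule continuous_on_ln_substitution[OF contG limG])
    qed (use that in auto)
    then show ?thesis using that by (simp add: h_def)
  qed
  then have "q t = 0"
    using primitive_zero_imp_zero[OF q, of "t + 1" t] \<open>0 < t\<close> by (simp add: G_def)
  then show ?thesis by (simp add: q_def)
qed

section \<open>Strongly continuous operator families\<close>

text \<open>Banach-Steinhaus through Baire's theorem. Some closed set \<open>T n\<close> contains a
  ball of radius \<open>r\<close> about \<open>x0\<close>; since \<open>f\<close> is at most n in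
  norm at the centre and at every point of the ball, subtraction bounds it on the ball of radius
  \<open>r\<close> about 0 by 2 n.\<close>

lemma uniform_boundedness:
  fixes F :: "('a::banach \<Rightarrow>\<^sub>L 'b::real_normed_vector) set"
  assumes "\<And>x. \<exists>C. \<forall>f\<in>F. norm (blinfun_apply f x) \<le> C"
  shows "\<exists>C>0. \<forall>f\<in>F. norm f \<le> C"
proof -
  define T where "T n = {x. \<forall>f\<in>F. norm (blinfun_apply f x) \<le> real n}" for n :: nat
  have closedT: "closed (T n)" for n
  proof -
    have "T n = (\<Inter>f\<in>F. {x. norm (blinfun_apply f x) \<le> real n})" by (auto simp: T_def)
    then show ?thesis by (auto intro!: closed_INT closed_Collect_le continuous_intros)
  qed
  have cover: "\<Union> (range T) = UNIV"
  proof -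
    have "x \<in> \<Union> (range T)" for x
    proof -
      obtain C where C: "\<forall>f\<in>F. norm (blinfun_apply f x) \<le> C" using assms by blast
      obtain n :: nat where "C \<le> real n" using real_arch_simple by blast
      with C have "x \<in> T n" by (auto simp: T_def intro: order_trans)
      then show ?thesis by blast
    qed
    then show ?thesis by blast
  qed
  have "\<exists>n. interior (T n) \<noteq> {}"
  proof (rule ccontr)
    assume "\<not> ?thesis"
    then have "Met_TC.mtopology interior_of \<Union> (range T) = {}"
      using closedT
      by (intro Met_TC.metric_Baire_category_alt) (auto simp: mcomplete_iff_complete complete_UNIV)
    then show False by (simp add: cover)
  qed
  then obtain n x0 where "x0 \<in> interior (T n)" by blast
  then obtain r where r: "0 < r" "cball x0 r \<subseteq> T n"
    by (meson interior_subset mem_interior_cball)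
  have "norm f \<le> 2 * real n / r" if f: "f \<in> F" for f
  proof (rule norm_blinfun_bound)
    show "norm (blinfun_apply f y) \<le> 2 * real n / r * norm y" for y
    proof (cases "y = 0")
      case False
      define c where "c = r / norm y"
      have c: "0 < c" using False r by (simp add: c_def)
      have "x0 + c *\<^sub>R y \<in> T n" "x0 \<in> T n"
        using r False by (auto simp: c_def dist_norm intro!: subsetD[OF r(2)])
      then have "norm (blinfun_apply f (x0 + c *\<^sub>R y)) \<le> n" "norm (blinfun_apply f x0) \<le> n"
        using f by (auto simp: T_def)
      then have "norm (blinfun_apply f (x0 + c *\<^sub>R y) - blinfun_apply f x0) \<le> real n + real n"
        using norm_triangle_ineq4[of "blinfun_apply f (x0 + c *\<^sub>R y)" "blinfun_apply f x0"] by linarith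
      then have "c * norm (blinfun_apply f y) \<le> 2 * real n"
        using c by (simp add: blinfun.add_right blinfun.scaleR_right)
      then show ?thesis using c False r by (simp add: c_def field_simps)
    qed simp
  qed (use r in simp)
  \<comment> \<open>The summand 1 keeps the bound positive when n = 0.\<close>
  then have "\<forall>f\<in>F. norm f \<le> 2 * real n / r + 1"
    by (meson less_add_one less_imp_le order_trans)
  moreover have "0 < 2 * real n / r + 1"
    using r by (intro add_nonneg_pos divide_nonneg_pos) auto
  ultimately show ?thesis by blast
qed

text \<open>Strong continuity does not make t \<mapsto> norm (S t) continuous. Compactness bounds
  each orbit separately, and the uniform boundedness principle turns these bounds into one.\<close>

lemma strongly_continuous_locally_bounded:
  fixes S :: "real \<Rightarrow> 'a::banach \<Rightarrow>\<^sub>L 'a"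
  assumes S: "strongly_continuous S" and "0 < a"
  shows "\<exists>C>0. \<forall>t\<in>{a..b}. norm (S t) \<le> C"
proof -
  have "\<exists>C>0. \<forall>f\<in>S ` {a..b}. norm f \<le> C"
  proof (rule uniform_boundedness)
    fix x
    have "continuous_on {a..b} (\<lambda>t. blinfun_apply (S t) x)"
      using S \<open>0 < a\<close> unfolding strongly_continuous_def
      by (meson atLeastAtMost_iff continuous_on_subset greaterThan_iff less_le_trans subsetI)
    then have "bounded ((\<lambda>t. blinfun_apply (S t) x) ` {a..b})"
      by (intro compact_imp_bounded compact_continuous_image) auto
    then show "\<exists>C. \<forall>f\<in>S ` {a..b}. norm (blinfun_apply f x) \<le> C"
      by (simp add: bounded_iff)
  qed
  then show ?thesis by auto
qed

text \<open>Operator and vector move together, so \<open>S (g w) (h w)\<close> is split as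
  \<open>S (g w) (h w - h z) + S (g w) (h z)\<close>. The local norm bound makes the first term
  small; strong continuity handles the second.\<close>

lemma continuous_on_strong_apply:
  fixes S :: "'b::topological_space \<Rightarrow> 'a::real_normed_vector \<Rightarrow>\<^sub>L 'c::real_normed_vector"
    and g :: "'d::t2_space \<Rightarrow> 'b"
  assumes S: "\<And>x. continuous_on U (\<lambda>t. blinfun_apply (S t) x)"
    and bound: "\<And>z. z \<in> Z \<Longrightarrow> \<exists>C. \<forall>\<^sub>F w in at z within Z. norm (S (g w)) \<le> C"
    and g: "continuous_on Z g" "g ` Z \<subseteq> U" and h: "continuous_on Z h"
  shows "continuous_on Z (\<lambda>z. blinfun_apply (S (g z)) (h z))"
  unfolding continuous_on_def
proof
  fix z assume z: "z \<in> Z"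
  obtain C where C: "\<forall>\<^sub>F w in at z within Z. norm (S (g w)) \<le> C" using bound[OF z] by blast
  have 1: "((\<lambda>w. blinfun_apply (S (g w)) (h z)) \<longlongrightarrow> blinfun_apply (S (g z)) (h z)) (at z within Z)"
    using continuous_on_compose2[OF S g] z unfolding continuous_on_def by blast
  have "((\<lambda>w. h w - h z) \<longlongrightarrow> 0) (at z within Z)"
    using h z by (simp add: continuous_on_def LIM_zero)
  then have "((\<lambda>w. C * norm (h w - h z)) \<longlongrightarrow> C * norm (0::'a)) (at z within Z)"
    by (intro tendsto_intros)
  then have 0: "((\<lambda>w. C * norm (h w - h z)) \<longlongrightarrow> 0) (at z within Z)" by simp
  have 2: "((\<lambda>w. blinfun_apply (S (g w)) (h w - h z)) \<longlongrightarrow> 0) (at z within Z)"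
  proof (rule Lim_null_comparison[OF _ 0])
    show "\<forall>\<^sub>F w in at z within Z. norm (blinfun_apply (S (g w)) (h w - h z)) \<le> C * norm (h w - h z)"
      using C by eventually_elim (meson mult_right_mono norm_blinfun norm_ge_zero order_trans)
  qed
  show "((\<lambda>z. blinfun_apply (S (g z)) (h z)) \<longlongrightarrow> blinfun_apply (S (g z)) (h z)) (at z within Z)"
    using tendsto_add[OF 2 1] by (simp add: blinfun.diff_right)
qed

text \<open>The endpoints are left out because nothing is known about \<open>S\<close> at 0, which
  is reached by s at one end and by t - s at the other. Setting both functions to 0 there does not
  change the integrals.\<close>

lemma norm_integral_le_interior:
  fixes f :: "real \<Rightarrow> 'a::banach"
  assumes f: "f integrable_on {a..b}" and h: "(h has_integral I) {a..b}"
    and le: "\<And>s. a < s \<Longrightarrow> s < b \<Longrightarrow> norm (f s) \<le> h s"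
  shows "norm (integral {a..b} f) \<le> I"
proof -
  define f' where "f' s = (if s \<in> {a<..<b} then f s else 0)" for s
  define h' where "h' s = (if s \<in> {a<..<b} then h s else 0)" for s
  have "(f has_integral integral {a..b} f) (cbox a b)"
    using integrable_integral[OF f] by simp
  then have "(f' has_integral integral {a..b} f) (cbox a b)"
    by (rule has_integral_spike_interior) (simp add: f'_def)
  moreover have "(h' has_integral I) (cbox a b)"
    by (rule has_integral_spike_interior[OF h[folded cbox_interval]]) (simp add: h'_def)
  moreover have "norm (f' s) \<le> h' s" for s
    using le by (auto simp: f'_def h'_def)
  ultimately show ?thesis
    using Henstock_Kurzweil_Integration.integral_norm_bound_integral[of f' "cbox a b" h']
    by (auto simp: integral_unique integrable_on_def)
qed

lemma has_integral_reflect_shift: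
  fixes f :: "real \<Rightarrow> 'a::banach"
  assumes "(f has_integral I) {0..t}"
  shows "((\<lambda>s. f (t - s)) has_integral I) {0..t}"
proof (cases "0 \<le> t")
  case True
  have "((\<lambda>x. f ((-1) *\<^sub>R x + t)) has_integral (1 / (\<bar>-1\<bar> ^ DIM(real))) *\<^sub>R I)
      ((\<lambda>x. (1 / -1) *\<^sub>R x + - ((1 / -1) *\<^sub>R t)) ` cbox 0 t)"
    by (rule has_integral_affinity) (use assms in auto)
  moreover have "(\<lambda>x. (1 / -1) *\<^sub>R x + - ((1 / -1) *\<^sub>R t)) ` cbox 0 t = {0..t}"
    using True by (auto simp: image_def intro!: bexI[of _ "t - _"])
  ultimately show ?thesis by simp
qed (use assms in auto)

lemma blinfun_operator_integral:
  fixes S :: "real \<Rightarrow> 'a::banach \<Rightarrow>\<^sub>L 'a"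
  assumes S: "strongly_continuous S"
    and bound: "\<And>t. 0 < t \<Longrightarrow> norm (S t) \<le> m t" and m: "m integrable_on {0..T}"
  shows "(\<lambda>t. blinfun_apply (S t) y) integrable_on {0..T}"
    and "bounded_linear (\<lambda>y. integral {0..T} (\<lambda>t. blinfun_apply (S t) y))"
    and "norm (integral {0..T} (\<lambda>t. blinfun_apply (S t) y)) \<le> integral {0..T} m * norm y"
proof -
  have le: "norm (blinfun_apply (S t) y) \<le> m t * norm y" if "0 < t" for t y
    by (meson bound[OF that] mult_right_mono norm_blinfun norm_ge_zero order_trans)
  have hi: "((\<lambda>t. m t * norm y) has_integral integral {0..T} m * norm y) {0..T}" for y
    using m by (intro has_integral_mult_left integrable_integral)
  show I: "(\<lambda>t. blinfun_apply (S t) y) integrable_on {0..T}" for y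
  proof (rule integrable_dominated_interior)
    show "continuous_on {0<..<T} (\<lambda>t. blinfun_apply (S t) y)"
      using S unfolding strongly_continuous_def
      by (meson continuous_on_subset greaterThanLessThan_iff greaterThan_iff subsetI)
    show "(\<lambda>t. m t * norm y) integrable_on {0..T}" using hi by blast
  qed (use le in auto)
  show B: "norm (integral {0..T} (\<lambda>t. blinfun_apply (S t) y)) \<le> integral {0..T} m * norm y" for y
    by (rule norm_integral_le_interior[OF I hi le])
  show "bounded_linear (\<lambda>y. integral {0..T} (\<lambda>t. blinfun_apply (S t) y))"
    by (rule bounded_linear_intro[where K = "integral {0..T} m"])
      (use B in \<open>auto simp: blinfun.add_right blinfun.scaleR_right I mult.commute
        Henstock_Kurzweil_Integration.integral_add\<close>)
qed

section \<open>Convolution of an operator family with its orbits\<close>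

text \<open>The majorant \<open>m\<close> replaces \<open>\<lambda>t. norm (S t)\<close>, whose integrability on \<open>{0..T}\<close> would need a
  measurability argument.\<close>

locale majorized_family =
  fixes S :: "real \<Rightarrow> 'a::banach \<Rightarrow>\<^sub>L 'a" and m :: "real \<Rightarrow> real"
  assumes strong: "strongly_continuous S"
    and bound: "0 < t \<Longrightarrow> norm (S t) \<le> m t"
    and m_nonneg: "0 \<le> m t"
    and m_integrable: "m integrable_on {0..T}"
begin

definition \<kappa> :: "real \<Rightarrow> real" where
  "\<kappa> T = integral {0..T} m"

text \<open>A strong operator integral: it is formed orbit by orbit, and the majorant
  \<open>m\<close> makes the result a bounded operator, which gives \<open>Blinfun\<close> its
  meaning here.\<close>

definition P :: "real \<Rightarrow> 'a \<Rightarrow>\<^sub>L 'a" where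
  "P T = Blinfun (\<lambda>y. integral {0..T} (\<lambda>t. blinfun_apply (S t) y))"

lemma P_apply: "blinfun_apply (P T) y = integral {0..T} (\<lambda>t. blinfun_apply (S t) y)"
  unfolding P_def
  by (subst bounded_linear_Blinfun_apply)
    (use blinfun_operator_integral(2)[OF strong bound m_integrable] in auto)

lemma norm_P: "norm (blinfun_apply (P T) y) \<le> \<kappa> T * norm y"
  unfolding P_apply \<kappa>_def
  using blinfun_operator_integral(3)[OF strong bound m_integrable] by auto

lemma \<kappa>_nonneg: "0 \<le> \<kappa> T"
  unfolding \<kappa>_def by (intro Henstock_Kurzweil_Integration.integral_nonneg m_integrable m_nonneg)

lemma norm_P_le: "norm (P T) \<le> \<kappa> T"
  by (intro norm_blinfun_bound norm_P \<kappa>_nonneg)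

lemma \<kappa>_0: "\<kappa> 0 = 0"
  by (simp add: \<kappa>_def)

lemma \<kappa>_mono: "s \<le> t \<Longrightarrow> \<kappa> s \<le> \<kappa> t"
  unfolding \<kappa>_def by (intro integral_subset_le m_integrable ballI m_nonneg) auto

lemma \<kappa>_has_integral: "(m has_integral \<kappa> T) {0..T}"
  unfolding \<kappa>_def by (rule integrable_integral[OF m_integrable])

lemma \<kappa>_continuous: "continuous_on {0..} \<kappa>"
  unfolding \<kappa>_def[abs_def]
  by (intro continuous_on_atLeastI indefinite_integral_continuous_1 m_integrable)

lemma truncated_majorant:
  assumes "0 \<le> c" "0 \<le> T"
  shows "((\<lambda>s. if s \<le> c then m s else 0) has_integral \<kappa> (min T c)) {0..T}"
proof -
  have "((\<lambda>s. if s \<in> {0..min T c} then m s else 0) has_integral \<kappa> (min T c)) {0..T}"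
    by (subst has_integral_restrict) (use \<kappa>_has_integral in auto)
  then show ?thesis
    by (rule has_integral_eq[rotated]) auto
qed

lemma orbit: "cont_loc_integrable (\<lambda>t. blinfun_apply (S t) x)"
  using strong blinfun_operator_integral(1)[OF strong bound m_integrable]
  by (auto simp: cont_loc_integrable_def strongly_continuous_def)

lemma norm_orbit: "0 < t \<Longrightarrow> norm (blinfun_apply (S t) x) \<le> m t * norm x"
  by (meson bound mult_right_mono norm_blinfun norm_ge_zero order_trans)

definition orbit_conv :: "'a \<Rightarrow> real \<Rightarrow> 'a" where
  "orbit_conv x t = integral {0..t} (\<lambda>s. blinfun_apply (S (t - s)) (blinfun_apply (S s) x))"

text \<open>Both factors may be singular, but not at the same s: the larger of s and t - s lies in
  {t/2..t}, where \<open>B\<close> applies, and only the other one needs the majorant.\<close>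

lemma norm_twice:
  assumes B: "\<forall>r\<in>{t/2..t}. norm (S r) \<le> B" and s: "0 < s" "s < t"
  shows "norm (blinfun_apply (S (t - s)) (blinfun_apply (S s) x)) \<le>
      B * norm x * (if t / 2 \<le> s then m (t - s) else m s)"
proof -
  have 1: "norm (blinfun_apply (S (t - s)) (blinfun_apply (S s) x)) \<le> norm (S (t - s)) * norm (S s) * norm x"
    by (metis (no_types, opaque_lifting) mult.assoc mult_left_mono norm_blinfun norm_ge_zero order_trans)
  have 2: "norm (S (t - s)) * norm (S s) \<le> B * (if t / 2 \<le> s then m (t - s) else m s)"
  proof (cases "t / 2 \<le> s")
    case True
    have "norm (S s) \<le> B" "norm (S (t - s)) \<le> m (t - s)"
      using B True s by (auto intro!: bound)
    then have "norm (S (t - s)) * norm (S s) \<le> m (t - s) * B"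
      by (intro mult_mono m_nonneg) auto
    with True show ?thesis by (simp add: mult.commute)
  next
    case False
    have "norm (S (t - s)) \<le> B" "norm (S s) \<le> m s"
      using B False s by (auto intro!: bound)
    then have "norm (S (t - s)) * norm (S s) \<le> B * m s"
      by (intro mult_mono m_nonneg) (auto intro: order_trans[OF norm_ge_zero])
    with False show ?thesis by simp
  qed
  show ?thesis
    using order_trans[OF 1 mult_right_mono[OF 2 norm_ge_zero]] by (simp only: mult_ac)
qed

lemma integrable_twice:
  "(\<lambda>s. blinfun_apply (S (t - s)) (blinfun_apply (S s) x)) integrable_on {0..t}"
proof (cases "0 < t")
  case False
  then have "{0..t} = {} \<or> {0..t} = cbox 0 0" by auto
  then show ?thesis by (elim disjE) (simp_all only: integrable_on_empty integrable_on_refl)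
next
  case True
  obtain B where B: "0 < B" "\<forall>r\<in>{t/2..t}. norm (S r) \<le> B"
    using strongly_continuous_locally_bounded[OF strong, of "t/2" t] True by auto
  show ?thesis
  proof (rule integrable_dominated_interior)
    show "continuous_on {0<..<t} (\<lambda>s. blinfun_apply (S (t - s)) (blinfun_apply (S s) x))"
    proof (rule continuous_on_strong_apply[where S = S and g = "\<lambda>s. t - s" and U = "{0<..}"])
      show "continuous_on {0<..} (\<lambda>t. blinfun_apply (S t) x)" for x
        using strong by (simp add: strongly_continuous_def)
      then show "continuous_on {0<..<t} (\<lambda>s. blinfun_apply (S s) x)"
        by (rule continuous_on_subset) auto
      show "\<exists>C. \<forall>\<^sub>F w in at s within {0<..<t}. norm (S (t - w)) \<le> C" if s: "s \<in> {0<..<t}" for s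
      proof -
        \<comment> \<open>For w near s, namely w < (t + s) / 2, the argument t - w stays above (t -
          s) / 2, so this constant serves a whole neighbourhood.\<close>
        obtain C where C: "\<forall>r\<in>{(t-s)/2..t}. norm (S r) \<le> C"
          using strongly_continuous_locally_bounded[OF strong, of "(t-s)/2" t] s by auto
        have "\<forall>\<^sub>F w in at s within {0<..<t}. w \<in> {0<..<(t+s)/2}"
          unfolding eventually_at_topological using s
          by (intro exI[of _ "{0<..<(t+s)/2}"]) (auto simp: field_simps)
        then have "\<forall>\<^sub>F w in at s within {0<..<t}. norm (S (t - w)) \<le> C"
          by eventually_elim (use C in \<open>auto simp: field_simps\<close>)
        then show ?thesis by blast
      qed
    qed (auto intro!: continuous_intros)
    show "(\<lambda>s. B * norm x * (m s + m (t - s))) integrable_on {0..t}"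
      using has_integral_reflect_shift[OF \<kappa>_has_integral, of t] m_integrable
      by (intro integrable_on_mult_right integrable_add) auto
    show "norm (blinfun_apply (S (t - s)) (blinfun_apply (S s) x)) \<le> B * norm x * (m s + m (t - s))"
      if "0 < s" "s < t" for s
      using norm_twice[OF B(2) that, of x] B(1) m_nonneg
      by (elim order_trans) (auto intro!: mult_left_mono)
  qed
qed

text \<open>Cutting \<open>S\<close> off near \<open>0\<close> removes the singularities at \<open>s = 0\<close> and \<open>s = t\<close> and makes
  \<open>(t, s) \<mapsto> S (t - s) (S s x)\<close> continuous on squares, so that the order of integration can be
  exchanged.\<close>

definition cutoff :: "real \<Rightarrow> real \<Rightarrow> real" where
  "cutoff e t = min 1 (max 0 (t / e - 1))"

lemma cutoff_range: "0 \<le> cutoff e t" "cutoff e t \<le> 1"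
  by (auto simp: cutoff_def)

lemma cutoff_eq_0: "0 < e \<Longrightarrow> t \<le> e \<Longrightarrow> cutoff e t = 0"
  by (simp add: cutoff_def)

lemma cutoff_eq_1: "0 < e \<Longrightarrow> 2 * e \<le> t \<Longrightarrow> cutoff e t = 1"
  by (simp add: cutoff_def field_simps)

definition S\<^sub>e :: "real \<Rightarrow> real \<Rightarrow> 'a \<Rightarrow>\<^sub>L 'a" where
  "S\<^sub>e e t = cutoff e t *\<^sub>R S t"

lemma S\<^sub>e_apply: "blinfun_apply (S\<^sub>e e t) x = cutoff e t *\<^sub>R blinfun_apply (S t) x"
  by (simp add: S\<^sub>e_def blinfun.scaleR_left)

lemma S\<^sub>e_eq_0: "0 < e \<Longrightarrow> t \<le> e \<Longrightarrow> S\<^sub>e e t = 0"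
  by (simp add: S\<^sub>e_def cutoff_eq_0)

lemma S\<^sub>e_eq_S: "0 < e \<Longrightarrow> 2 * e \<le> t \<Longrightarrow> S\<^sub>e e t = S t"
  by (simp add: S\<^sub>e_def cutoff_eq_1)

lemma norm_S\<^sub>e: "norm (S\<^sub>e e t) \<le> norm (S t)"
  using cutoff_range[of e t] by (simp add: S\<^sub>e_def mult_left_le_one_le)

lemma norm_S\<^sub>e_le:
  assumes "0 < e" shows "norm (S\<^sub>e e t) \<le> m t"
proof (cases "t \<le> e")
  case True
  then show ?thesis using assms by (simp add: S\<^sub>e_eq_0 m_nonneg)
next
  case False
  then show ?thesis using assms norm_S\<^sub>e[of e t] bound[of t] by linarith
qed

text \<open>Continuity is glued from the overlapping open sets {0<..} and {..<e}; on the second the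
  family is 0, which carries it past the singularity to the whole line.\<close>

lemma S\<^sub>e_continuous:
  assumes e: "0 < e"
  shows "continuous_on UNIV (\<lambda>t. blinfun_apply (S\<^sub>e e t) x)"
proof -
  have "continuous_on {0<..} (\<lambda>t. blinfun_apply (S\<^sub>e e t) x)"
    unfolding S\<^sub>e_apply cutoff_def using orbit[of x] e
    by (auto simp: cont_loc_integrable_def intro!: continuous_intros)
  moreover have "continuous_on {..<e} (\<lambda>t. blinfun_apply (S\<^sub>e e t) x)"
    by (rule continuous_on_eq[of _ "\<lambda>_. 0"]) (use e in \<open>auto simp: S\<^sub>e_eq_0\<close>)
  ultimately have "continuous_on ({0<..} \<union> {..<e}) (\<lambda>t. blinfun_apply (S\<^sub>e e t) x)"
    by (intro continuous_on_open_Un) auto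
  moreover have "{0<..} \<union> {..<e} = UNIV" using e by auto
  ultimately show ?thesis by simp
qed

lemma S\<^sub>e_bounded:
  assumes e: "0 < e" obtains C where "0 < C" "\<And>t. t \<le> N \<Longrightarrow> norm (S\<^sub>e e t) \<le> C"
proof -
  obtain C where C: "0 < C" "\<forall>t\<in>{e..N}. norm (S t) \<le> C"
    using strongly_continuous_locally_bounded[OF strong e] by blast
  have "norm (S\<^sub>e e t) \<le> C" if "t \<le> N" for t
  proof (cases "t \<le> e")
    case True
    then show ?thesis using C e by (simp add: S\<^sub>e_eq_0)
  next
    case False
    then show ?thesis using C(2) that norm_S\<^sub>e[of e t] by (auto intro: order_trans)
  qed
  with C(1) show thesis by (rule that)
qed

lemma S\<^sub>e_twice_continuous:
  assumes e: "0 < e"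
  shows "continuous_on UNIV (\<lambda>(t, s). blinfun_apply (S\<^sub>e e (t - s)) (blinfun_apply (S\<^sub>e e s) x))"
  unfolding case_prod_unfold
proof (rule continuous_on_strong_apply[where S = "S\<^sub>e e" and g = "\<lambda>z. fst z - snd z" and U = UNIV])
  show "continuous_on UNIV (\<lambda>t. blinfun_apply (S\<^sub>e e t) x)" for x
    by (rule S\<^sub>e_continuous[OF e])
  show "continuous_on UNIV (\<lambda>z::real \<times> real. blinfun_apply (S\<^sub>e e (snd z)) x)"
    by (intro continuous_on_compose2[OF S\<^sub>e_continuous[OF e]] continuous_intros) auto
  fix z :: "real \<times> real"
  obtain C where C: "\<And>t. t \<le> fst z - snd z + 1 \<Longrightarrow> norm (S\<^sub>e e t) \<le> C"
    using S\<^sub>e_bounded[OF e] by metis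
  have "\<forall>\<^sub>F w in at z. fst w - snd w < fst z - snd z + 1"
    by (rule order_tendstoD(2)[where y = "fst z - snd z"]) (auto intro!: tendsto_intros)
  then have "\<forall>\<^sub>F w in at z. norm (S\<^sub>e e (fst w - snd w)) \<le> C"
    by eventually_elim (simp add: C)
  then show "\<exists>C. \<forall>\<^sub>F w in at z. norm (S\<^sub>e e (fst w - snd w)) \<le> C" by blast
qed (auto intro!: continuous_intros)

section \<open>The regularised convolution and the exchange of integrals\<close>

definition conv\<^sub>e :: "real \<Rightarrow> 'a \<Rightarrow> real \<Rightarrow> 'a" where
  "conv\<^sub>e e x t = integral {0..t} (\<lambda>s. blinfun_apply (S\<^sub>e e (t - s)) (blinfun_apply (S\<^sub>e e s) x))"

definition P\<^sub>e :: "real \<Rightarrow> real \<Rightarrow> 'a \<Rightarrow> 'a" where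
  "P\<^sub>e e T y = integral {0..T} (\<lambda>r. blinfun_apply (S\<^sub>e e r) y)"

lemma S\<^sub>e_integrable: "0 < e \<Longrightarrow> (\<lambda>r. blinfun_apply (S\<^sub>e e r) y) integrable_on {a..b}"
  by (intro integrable_continuous_real continuous_on_subset[OF S\<^sub>e_continuous]) auto

lemma S\<^sub>e_twice_integrable:
  assumes "0 < e"
  shows "(\<lambda>s. blinfun_apply (S\<^sub>e e (t - s)) (blinfun_apply (S\<^sub>e e s) x)) integrable_on {a..b}"
proof -
  have "continuous_on {a..b} (\<lambda>s. (\<lambda>(t, s). blinfun_apply (S\<^sub>e e (t - s)) (blinfun_apply (S\<^sub>e e s) x)) (t, s))"
    by (rule continuous_on_compose2[OF S\<^sub>e_twice_continuous[OF assms]]) (auto intro!: continuous_intros)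
  then show ?thesis by (intro integrable_continuous_real) simp
qed

text \<open>As \<open>S\<^sub>e\<close> vanishes at nonpositive arguments, the triangle s \<le> t
  may be completed to a square. The theorems on continuity and exchange of parameter integrals work
  over such a fixed interval.\<close>

lemma conv\<^sub>e_extend:
  assumes e: "0 < e" and t: "0 \<le> t" "t \<le> N"
  shows "conv\<^sub>e e x t = integral {0..N} (\<lambda>s. blinfun_apply (S\<^sub>e e (t - s)) (blinfun_apply (S\<^sub>e e s) x))"
proof -
  let ?f = "\<lambda>s. blinfun_apply (S\<^sub>e e (t - s)) (blinfun_apply (S\<^sub>e e s) x)"
  have "integral {0..t} ?f + integral {t..N} ?f = integral {0..N} ?f"
    using t by (intro Henstock_Kurzweil_Integration.integral_combine S\<^sub>e_twice_integrable[OF e])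
  moreover have "integral {t..N} ?f = integral {t..N} (\<lambda>_. 0)"
    using e by (intro integral_cong) (simp add: S\<^sub>e_eq_0)
  ultimately show ?thesis by (simp add: conv\<^sub>e_def)
qed

lemma conv\<^sub>e_continuous:
  assumes e: "0 < e"
  shows "continuous_on {0..N} (conv\<^sub>e e x)"
proof -
  have "continuous_on {0..N} (\<lambda>t. integral (cbox 0 N)
      (\<lambda>s. blinfun_apply (S\<^sub>e e (t - s)) (blinfun_apply (S\<^sub>e e s) x)))"
    by (intro integral_continuous_on_param continuous_on_subset[OF S\<^sub>e_twice_continuous[OF e]]) auto
  then show ?thesis
    by (rule continuous_on_eq) (use conv\<^sub>e_extend[OF e] in auto)
qed

lemma integral_S\<^sub>e_shift:
  assumes e: "0 < e" and s: "0 \<le> s" "s \<le> N"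
  shows "integral {0..N} (\<lambda>t. blinfun_apply (S\<^sub>e e (t - s)) y) = P\<^sub>e e (N - s) y"
proof -
  let ?f = "\<lambda>t. blinfun_apply (S\<^sub>e e (t - s)) y"
  have I: "?f integrable_on {a..b}" for a b
    by (intro integrable_continuous_real continuous_on_compose2[OF S\<^sub>e_continuous[OF e]] continuous_intros) auto
  have "integral {0..s} ?f + integral {s..N} ?f = integral {0..N} ?f"
    using s by (intro Henstock_Kurzweil_Integration.integral_combine I)
  moreover have "integral {0..s} ?f = integral {0..s} (\<lambda>_. 0)"
    using e by (intro integral_cong) (simp add: S\<^sub>e_eq_0)
  moreover have "integral {s..N} ?f = P\<^sub>e e (N - s) y"
    using integral_shift_Icc_real[of 0 "N - s" ?f s] by (simp add: P\<^sub>e_def o_def)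
  ultimately show ?thesis by simp
qed

text \<open>Fubini for a continuous kernel on a square. After the exchange the inner integral in t
  runs effectively over {s..N} and is the regularised primitive at N - s.\<close>

lemma integral_conv\<^sub>e:
  assumes e: "0 < e" and "0 \<le> N"
  shows "integral {0..N} (conv\<^sub>e e x) = integral {0..N} (\<lambda>s. P\<^sub>e e (N - s) (blinfun_apply (S\<^sub>e e s) x))"
proof -
  let ?f = "\<lambda>t s. blinfun_apply (S\<^sub>e e (t - s)) (blinfun_apply (S\<^sub>e e s) x)"
  have "integral {0..N} (conv\<^sub>e e x) = integral (cbox 0 N) (\<lambda>t. integral (cbox 0 N) (?f t))"
    using conv\<^sub>e_extend[OF e] by (auto intro!: integral_cong)
  also have "\<dots> = integral (cbox 0 N) (\<lambda>s. integral (cbox 0 N) (\<lambda>t. ?f t s))"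
    by (intro integral_swap_continuous continuous_on_subset[OF S\<^sub>e_twice_continuous[OF e]]) auto
  also have "\<dots> = integral {0..N} (\<lambda>s. P\<^sub>e e (N - s) (blinfun_apply (S\<^sub>e e s) x))"
    using integral_S\<^sub>e_shift[OF e] by (auto intro!: integral_cong)
  finally show ?thesis .
qed

text \<open>Regularisation multiplies \<open>S\<close> by a factor in [0,1] and changes it only
  below 2 e, so the mass of \<open>m\<close> there bounds the error, uniformly in
  \<open>T\<close>.\<close>

lemma P\<^sub>e_diff:
  assumes e: "0 < e" and T: "0 \<le> T"
  shows "norm (P\<^sub>e e T y - blinfun_apply (P T) y) \<le> \<kappa> (2 * e) * norm y"
proof -
  have I: "(\<lambda>r. blinfun_apply (S r) y) integrable_on {0..T}"
    using orbit by (simp add: cont_loc_integrable_def)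
  have "norm (integral {0..T} (\<lambda>r. blinfun_apply (S\<^sub>e e r) y - blinfun_apply (S r) y)) \<le> \<kappa> (min T (2 * e)) * norm y"
  proof (rule norm_integral_le_interior)
    show "((\<lambda>s. (if s \<le> 2 * e then m s else 0) * norm y) has_integral \<kappa> (min T (2 * e)) * norm y) {0..T}"
      using e T by (intro has_integral_mult_left truncated_majorant) auto
    show "norm (blinfun_apply (S\<^sub>e e s) y - blinfun_apply (S s) y) \<le> (if s \<le> 2 * e then m s else 0) * norm y"
      if "0 < s" for s
    proof (cases "s \<le> 2 * e")
      case True
      have "blinfun_apply (S\<^sub>e e s) y - blinfun_apply (S s) y = - ((1 - cutoff e s) *\<^sub>R blinfun_apply (S s) y)"
        by (simp add: S\<^sub>e_apply algebra_simps)
      also have "norm \<dots> \<le> norm (blinfun_apply (S s) y)"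
        using cutoff_range[of e s] by (simp add: mult_left_le_one_le)
      also have "\<dots> \<le> m s * norm y" by (rule norm_orbit[OF that])
      finally show ?thesis using True by simp
    qed (use e in \<open>simp add: S\<^sub>e_eq_S\<close>)
  qed (intro integrable_diff I S\<^sub>e_integrable[OF e])
  also have "\<dots> \<le> \<kappa> (2 * e) * norm y"
    by (intro mult_right_mono \<kappa>_mono) auto
  finally show ?thesis
    by (simp add: P\<^sub>e_def P_apply Henstock_Kurzweil_Integration.integral_diff I S\<^sub>e_integrable[OF e])
qed

text \<open>The integrand changes only where s < 2 e or t - s < 2 e. Since 4 e \<le> t, these zones
  lie in opposite halves of the interval, so in each the other factor is bounded by
  \<open>B\<close>; each zone contributes \<kappa>(2 e).\<close>

lemma conv\<^sub>e_diff:
  assumes e: "0 < e" "4 * e \<le> t" and B: "\<forall>r\<in>{t/2..t}. norm (S r) \<le> B"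
  shows "norm (conv\<^sub>e e x t - orbit_conv x t) \<le> 2 * B * norm x * \<kappa> (2 * e)"
proof -
  define g where "g s = (if s \<le> 2 * e then m s else 0)" for s
  have t: "0 < t" using e by simp
  have B0: "0 \<le> B"
    using bspec[OF B, of t] t by (auto intro: order_trans[OF norm_ge_zero])
  have g: "(g has_integral \<kappa> (2 * e)) {0..t}"
    unfolding g_def using truncated_majorant[of "2 * e" t] e by (simp add: min_def)
  let ?d = "\<lambda>s. blinfun_apply (S\<^sub>e e (t - s)) (blinfun_apply (S\<^sub>e e s) x)
      - blinfun_apply (S (t - s)) (blinfun_apply (S s) x)"
  have "norm (integral {0..t} ?d) \<le> B * norm x * (\<kappa> (2 * e) + \<kappa> (2 * e))"
  proof (rule norm_integral_le_interior)
    show "((\<lambda>s. B * norm x * (g s + g (t - s))) has_integral B * norm x * (\<kappa> (2 * e) + \<kappa> (2 * e))) {0..t}"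
      by (intro has_integral_mult_right has_integral_add g has_integral_reflect_shift)
    show "norm (?d s) \<le> B * norm x * (g s + g (t - s))" if s: "0 < s" "s < t" for s
    proof -
      define c where "c = cutoff e (t - s) * cutoff e s"
      have c: "0 \<le> c" "c \<le> 1"
        using cutoff_range by (auto simp: c_def intro: mult_le_one)
      have "?d s = - ((1 - c) *\<^sub>R blinfun_apply (S (t - s)) (blinfun_apply (S s) x))"
        by (simp add: S\<^sub>e_apply blinfun.scaleR_right c_def algebra_simps)
      then have eq: "norm (?d s) = (1 - c) * norm (blinfun_apply (S (t - s)) (blinfun_apply (S s) x))"
        using c by simp
      have gpos: "0 \<le> g r" for r by (simp add: g_def m_nonneg)
      show ?thesis
      proof (cases "2 * e \<le> s \<and> 2 * e \<le> t - s")
        case True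
        then have "c = 1" using e by (simp add: c_def cutoff_eq_1)
        then show ?thesis using eq B0 gpos by simp
      next
        case False
        have "norm (?d s) \<le> norm (blinfun_apply (S (t - s)) (blinfun_apply (S s) x))"
          unfolding eq using c by (simp add: mult_left_le_one_le)
        also have "\<dots> \<le> B * norm x * (if t / 2 \<le> s then m (t - s) else m s)"
          by (rule norm_twice[OF B s])
        also have "\<dots> \<le> B * norm x * (g s + g (t - s))"
          using False e B0 m_nonneg gpos
          by (intro mult_left_mono) (auto simp: g_def field_simps)
        finally show ?thesis .
      qed
    qed
  qed (intro integrable_diff integrable_twice S\<^sub>e_twice_integrable e)
  then show ?thesis
    by (simp add: conv\<^sub>e_def orbit_conv_def Henstock_Kurzweil_Integration.integral_diff
        integrable_twice S\<^sub>e_twice_integrable e)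
qed

text \<open>What Fubini yields for the integral of \<open>orbit_conv x\<close> over {0..N}. It is
  introduced on its own because this candidate primitive is what later proves that
  \<open>orbit_conv x\<close> is integrable near 0.\<close>

definition int_conv :: "'a \<Rightarrow> real \<Rightarrow> 'a" where
  "int_conv x N = integral {0..N} (\<lambda>s. blinfun_apply (P (N - s)) (blinfun_apply (S s) x))"

lemma P_continuous: "continuous_on {0..} (\<lambda>t. blinfun_apply (P t) y)"
  unfolding P_apply by (rule primitive_continuous[OF orbit])

lemma norm_P_S:
  assumes "0 < s" "s < N"
  shows "norm (blinfun_apply (P (N - s)) (blinfun_apply (S s) x)) \<le> \<kappa> N * norm x * m s"
proof -
  have "norm (blinfun_apply (P (N - s)) (blinfun_apply (S s) x)) \<le> \<kappa> (N - s) * norm (blinfun_apply (S s) x)"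
    by (rule norm_P)
  also have "\<dots> \<le> \<kappa> N * (m s * norm x)"
    using assms by (intro mult_mono \<kappa>_mono norm_orbit \<kappa>_nonneg) auto
  finally show ?thesis by (simp add: mult_ac)
qed

lemma P_S_integrable:
  "(\<lambda>s. blinfun_apply (P (N - s)) (blinfun_apply (S s) x)) integrable_on {0..N}"
proof (rule integrable_dominated_interior)
  show "(\<lambda>s. \<kappa> N * norm x * m s) integrable_on {0..N}"
    by (intro integrable_on_mult_right m_integrable)
  show "continuous_on {0<..<N} (\<lambda>s. blinfun_apply (P (N - s)) (blinfun_apply (S s) x))"
  proof (rule continuous_on_strong_apply[where S = P and g = "\<lambda>s. N - s" and U = "{0..}", OF P_continuous])
    show "continuous_on {0<..<N} (\<lambda>s. blinfun_apply (S s) x)"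
      using orbit[of x] unfolding cont_loc_integrable_def
      by (intro continuous_on_subset[of "{0<..}" _ "{0<..<N}"]) auto
    show "\<exists>C. \<forall>\<^sub>F w in at s within {0<..<N}. norm (P (N - w)) \<le> C" if "s \<in> {0<..<N}" for s
    proof (intro exI[of _ "\<kappa> N"])
      have "\<forall>\<^sub>F w in at s within {0<..<N}. w \<in> {0<..<N}"
        by (auto simp: eventually_at_filter)
      then show "\<forall>\<^sub>F w in at s within {0<..<N}. norm (P (N - w)) \<le> \<kappa> N"
        by eventually_elim (auto intro: order_trans[OF norm_P_le \<kappa>_mono])
    qed
  qed (auto intro!: continuous_intros)
qed (rule norm_P_S)

lemma norm_int_conv:
  "norm (int_conv x N) \<le> \<kappa> N * norm x * \<kappa> N"
  unfolding int_conv_def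
  by (rule norm_integral_le_interior[OF P_S_integrable has_integral_mult_right[OF \<kappa>_has_integral] norm_P_S])

lemma P\<^sub>e_S\<^sub>e_integrable:
  assumes e: "0 < e" and N: "0 \<le> N"
  shows "(\<lambda>s. P\<^sub>e e (N - s) (blinfun_apply (S\<^sub>e e s) x)) integrable_on {0..N}"
proof -
  let ?f = "\<lambda>s t. blinfun_apply (S\<^sub>e e (t - s)) (blinfun_apply (S\<^sub>e e s) x)"
  have "continuous_on ({0..N} \<times> cbox 0 N)
      (\<lambda>z. (\<lambda>(t, s). blinfun_apply (S\<^sub>e e (t - s)) (blinfun_apply (S\<^sub>e e s) x)) (snd z, fst z))"
    by (rule continuous_on_compose2[OF S\<^sub>e_twice_continuous[OF e]]) (auto intro!: continuous_intros)
  then have "continuous_on ({0..N} \<times> cbox 0 N) (\<lambda>(s, t). ?f s t)"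
    by (simp add: case_prod_unfold)
  then have "continuous_on {0..N} (\<lambda>s. integral (cbox 0 N) (?f s))"
    by (rule integral_continuous_on_param)
  then have "continuous_on {0..N} (\<lambda>s. P\<^sub>e e (N - s) (blinfun_apply (S\<^sub>e e s) x))"
    by (rule continuous_on_eq) (use integral_S\<^sub>e_shift[OF e] in auto)
  then show ?thesis by (rule integrable_continuous_real)
qed

text \<open>Operator and vector are replaced one at a time: changing the primitive costs \<kappa>(2
  e) by \<open>P\<^sub>e_diff\<close>, and changing the orbit costs only where s \<le> 2 e. The
  bound involves \<kappa> alone and no local bound on the operators, so it reaches down to N =
  0.\<close>

lemma integral_conv\<^sub>e_diff:
  assumes e: "0 < e" and N: "0 \<le> N"
  shows "norm (integral {0..N} (conv\<^sub>e e x) - int_conv x N) \<le> 2 * \<kappa> N * norm x * \<kappa> (2 * e)"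
proof -
  define g where "g s = (if s \<le> 2 * e then m s else 0)" for s
  have g: "(g has_integral \<kappa> (min N (2 * e))) {0..N}"
    unfolding g_def using e N by (intro truncated_majorant) auto
  let ?d = "\<lambda>s. P\<^sub>e e (N - s) (blinfun_apply (S\<^sub>e e s) x) - blinfun_apply (P (N - s)) (blinfun_apply (S s) x)"
  have "norm (integral {0..N} ?d) \<le> \<kappa> (2 * e) * norm x * \<kappa> N + \<kappa> N * norm x * \<kappa> (min N (2 * e))"
  proof (rule norm_integral_le_interior)
    show "((\<lambda>s. \<kappa> (2 * e) * norm x * m s + \<kappa> N * norm x * g s) has_integral
        \<kappa> (2 * e) * norm x * \<kappa> N + \<kappa> N * norm x * \<kappa> (min N (2 * e))) {0..N}"
      by (intro has_integral_add has_integral_mult_right g \<kappa>_has_integral)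
    show "norm (?d s) \<le> \<kappa> (2 * e) * norm x * m s + \<kappa> N * norm x * g s" if s: "0 < s" "s < N" for s
    proof -
      have "?d s = (P\<^sub>e e (N - s) (blinfun_apply (S\<^sub>e e s) x) - blinfun_apply (P (N - s)) (blinfun_apply (S\<^sub>e e s) x))
          + blinfun_apply (P (N - s)) (blinfun_apply (S\<^sub>e e s) x - blinfun_apply (S s) x)"
        by (simp add: blinfun.diff_right)
      also have "norm \<dots> \<le> \<kappa> (2 * e) * (m s * norm x) + \<kappa> N * (g s * norm x)"
      proof (rule order_trans[OF norm_triangle_ineq add_mono])
        have "norm (P\<^sub>e e (N - s) (blinfun_apply (S\<^sub>e e s) x) - blinfun_apply (P (N - s)) (blinfun_apply (S\<^sub>e e s) x))
            \<le> \<kappa> (2 * e) * norm (blinfun_apply (S\<^sub>e e s) x)"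
          using s by (intro P\<^sub>e_diff e) auto
        also have "norm (blinfun_apply (S\<^sub>e e s) x) \<le> m s * norm x"
          by (meson e mult_right_mono norm_S\<^sub>e_le norm_blinfun norm_ge_zero order_trans)
        finally show "norm (P\<^sub>e e (N - s) (blinfun_apply (S\<^sub>e e s) x) - blinfun_apply (P (N - s)) (blinfun_apply (S\<^sub>e e s) x))
            \<le> \<kappa> (2 * e) * (m s * norm x)"
          using \<kappa>_nonneg by (simp add: mult_left_mono)
        have *: "norm (blinfun_apply (S\<^sub>e e s) x - blinfun_apply (S s) x) \<le> g s * norm x"
        proof (cases "s \<le> 2 * e")
          case True
          have "blinfun_apply (S\<^sub>e e s) x - blinfun_apply (S s) x = - ((1 - cutoff e s) *\<^sub>R blinfun_apply (S s) x)"
            by (simp add: S\<^sub>e_apply algebra_simps)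
          also have "norm \<dots> \<le> norm (blinfun_apply (S s) x)"
            using cutoff_range[of e s] by (simp add: mult_left_le_one_le)
          also have "\<dots> \<le> m s * norm x" by (rule norm_orbit[OF s(1)])
          finally show ?thesis using True by (simp add: g_def)
        qed (use e in \<open>simp add: S\<^sub>e_eq_S g_def\<close>)
        have "norm (blinfun_apply (P (N - s)) (blinfun_apply (S\<^sub>e e s) x - blinfun_apply (S s) x))
            \<le> \<kappa> (N - s) * norm (blinfun_apply (S\<^sub>e e s) x - blinfun_apply (S s) x)"
          by (rule norm_P)
        also have "\<dots> \<le> \<kappa> N * (g s * norm x)"
          using s by (intro mult_mono \<kappa>_mono * \<kappa>_nonneg) auto
        finally show "norm (blinfun_apply (P (N - s)) (blinfun_apply (S\<^sub>e e s) x - blinfun_apply (S s) x))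
            \<le> \<kappa> N * (g s * norm x)" .
      qed
      finally show ?thesis by (simp add: mult_ac)
    qed
  qed (intro integrable_diff P_S_integrable P\<^sub>e_S\<^sub>e_integrable e N)
  also have "\<dots> \<le> \<kappa> (2 * e) * norm x * \<kappa> N + \<kappa> N * norm x * \<kappa> (2 * e)"
    by (intro add_left_mono mult_left_mono \<kappa>_mono mult_nonneg_nonneg \<kappa>_nonneg) auto
  finally show ?thesis
    by (simp add: integral_conv\<^sub>e[OF e N] int_conv_def Henstock_Kurzweil_Integration.integral_diff
        P_S_integrable P\<^sub>e_S\<^sub>e_integrable e N mult_ac)
qed

section \<open>Removal of the cutoff\<close>

lemma \<kappa>_tendsto_0: "(\<lambda>n. \<kappa> (2 * inverse (real (Suc n)))) \<longlonglongrightarrow> 0"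
proof -
  have "(\<lambda>n. 2 * inverse (real (Suc n))) \<longlonglongrightarrow> 2 * 0"
    by (intro tendsto_intros LIMSEQ_inverse_real_of_nat)
  then have "(\<lambda>n. \<kappa> (2 * inverse (real (Suc n)))) \<longlonglongrightarrow> \<kappa> 0"
    by (intro continuous_on_tendsto_compose[OF \<kappa>_continuous]) auto
  then show ?thesis by (simp add: \<kappa>_0)
qed

text \<open>The interval stays away from 0 because the constant in \<open>conv\<^sub>e_diff\<close>
  must bound \<open>S\<close> on {t/2..t} for all t at once, that is on {\<delta>/2..N}; the cutoff
  parameter also has to drop below \<delta> / 4.\<close>

lemma conv\<^sub>e_uniform_limit:
  assumes \<delta>: "0 < \<delta>"
  shows "uniform_limit {\<delta>..N} (\<lambda>n. conv\<^sub>e (inverse (real (Suc n))) x) (orbit_conv x) sequentially"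
proof (rule uniform_limitI)
  fix \<epsilon> :: real assume \<epsilon>: "0 < \<epsilon>"
  obtain B where B: "0 < B" "\<forall>r\<in>{\<delta>/2..N}. norm (S r) \<le> B"
    using strongly_continuous_locally_bounded[OF strong, of "\<delta>/2"] \<delta> by auto
  have "(\<lambda>n. 2 * B * norm x * \<kappa> (2 * inverse (real (Suc n)))) \<longlonglongrightarrow> 2 * B * norm x * 0"
    by (intro tendsto_intros \<kappa>_tendsto_0)
  then have 1: "\<forall>\<^sub>F n in sequentially. 2 * B * norm x * \<kappa> (2 * inverse (real (Suc n))) < \<epsilon>"
    by (rule order_tendstoD(2)) (use \<epsilon> in simp)
  have "(\<lambda>n. 4 * inverse (real (Suc n))) \<longlonglongrightarrow> 4 * 0"
    by (intro tendsto_intros LIMSEQ_inverse_real_of_nat)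
  then have 2: "\<forall>\<^sub>F n in sequentially. 4 * inverse (real (Suc n)) < \<delta>"
    by (rule order_tendstoD(2)) (use \<delta> in simp)
  show "\<forall>\<^sub>F n in sequentially. \<forall>t\<in>{\<delta>..N}. dist (conv\<^sub>e (inverse (real (Suc n))) x t) (orbit_conv x t) < \<epsilon>"
    using 1 2
  proof eventually_elim
    case (elim n)
    show ?case
    proof
      fix t assume t: "t \<in> {\<delta>..N}"
      have "norm (conv\<^sub>e (inverse (real (Suc n))) x t - orbit_conv x t)
          \<le> 2 * B * norm x * \<kappa> (2 * inverse (real (Suc n)))"
      proof (rule conv\<^sub>e_diff)
        show "4 * inverse (real (Suc n)) \<le> t" using elim(2) t by simp
        show "\<forall>r\<in>{t/2..t}. norm (S r) \<le> B" using B(2) t by auto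
      qed simp
      with elim(1) show "dist (conv\<^sub>e (inverse (real (Suc n))) x t) (orbit_conv x t) < \<epsilon>"
        by (simp only: dist_norm)
    qed
  qed
qed

lemma orbit_conv_continuous: "0 < \<delta> \<Longrightarrow> continuous_on {\<delta>..N} (orbit_conv x)"
  by (rule uniform_limit_theorem[OF _ conv\<^sub>e_uniform_limit])
    (intro always_eventually allI continuous_on_subset[OF conv\<^sub>e_continuous[of _ N]], auto)

text \<open>Two limits of the same integrals: those from 0 converge to \<open>int_conv\<close> by
  \<open>integral_conv\<^sub>e_diff\<close>, while on {\<delta>..N} uniform convergence gives the
  integral of \<open>orbit_conv\<close>. In this way \<open>orbit_conv\<close> itself is never
  integrated up to 0.\<close>

lemma int_conv_increment:
  assumes \<delta>: "0 < \<delta>" "\<delta> \<le> N"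
  shows "int_conv x N - int_conv x \<delta> = integral {\<delta>..N} (orbit_conv x)"
proof -
  define e where "e n = inverse (real (Suc n))" for n
  have e: "0 < e n" for n by (simp add: e_def)
  have lim: "(\<lambda>n. integral {0..T} (conv\<^sub>e (e n) x)) \<longlonglongrightarrow> int_conv x T" if "0 \<le> T" for T
  proof -
    have "(\<lambda>n. 2 * \<kappa> T * norm x * \<kappa> (2 * e n)) \<longlonglongrightarrow> 2 * \<kappa> T * norm x * 0"
      unfolding e_def by (intro tendsto_intros \<kappa>_tendsto_0)
    then have "(\<lambda>n. integral {0..T} (conv\<^sub>e (e n) x) - int_conv x T) \<longlonglongrightarrow> 0"
      by (intro Lim_null_comparison[OF always_eventually[OF allI[OF integral_conv\<^sub>e_diff[OF e that]]]]) simp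
    then show ?thesis by (rule LIM_zero_cancel)
  qed
  obtain I J where I: "\<And>n. (conv\<^sub>e (e n) x has_integral I n) {\<delta>..N}"
      and J: "(orbit_conv x has_integral J) {\<delta>..N}" and IJ: "(I \<longlongrightarrow> J) sequentially"
  proof (rule uniform_limit_integral[OF conv\<^sub>e_uniform_limit[OF \<delta>(1), where N = N and x = x, folded e_def]])
    show "continuous_on {\<delta>..N} (conv\<^sub>e (e n) x)" for n
      using \<delta> by (intro continuous_on_subset[OF conv\<^sub>e_continuous[OF e, of N]]) auto
  qed auto
  have "I n = integral {0..N} (conv\<^sub>e (e n) x) - integral {0..\<delta>} (conv\<^sub>e (e n) x)" for n
  proof -
    have "integral {0..\<delta>} (conv\<^sub>e (e n) x) + integral {\<delta>..N} (conv\<^sub>e (e n) x) = integral {0..N} (conv\<^sub>e (e n) x)"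
      using \<delta> by (intro Henstock_Kurzweil_Integration.integral_combine integrable_continuous_real
          conv\<^sub>e_continuous e) auto
    then show ?thesis using integral_unique[OF I[of n]] by (simp add: algebra_simps)
  qed
  then have "I = (\<lambda>n. integral {0..N} (conv\<^sub>e (e n) x) - integral {0..\<delta>} (conv\<^sub>e (e n) x))"
    by blast
  then have "(I \<longlongrightarrow> int_conv x N - int_conv x \<delta>) sequentially"
    using \<delta> by (simp add: tendsto_diff lim)
  with IJ have "J = int_conv x N - int_conv x \<delta>"
    using LIMSEQ_unique by blast
  then show ?thesis using integral_unique[OF J] by simp
qed

text \<open>The increments make \<open>int_conv x\<close> a primitive on the open half line, and its
  bound \<kappa>(t)^2 norm x makes it continuous at 0. A continuous primitive yields integrability
  of the convolution near 0 together with its integral.\<close>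

theorem orbit_conv_primitive:
  shows orbit_conv_cont_loc_integrable: "cont_loc_integrable (orbit_conv x)"
    and integral_orbit_conv: "0 \<le> N \<Longrightarrow> integral {0..N} (orbit_conv x) = int_conv x N"
proof -
  have cont: "continuous_on {0<..} (orbit_conv x)"
    unfolding continuous_on_eq_continuous_at[OF open_greaterThan]
  proof
    fix t :: real assume t: "t \<in> {0<..}"
    then have "continuous_on {t/2<..<t+1} (orbit_conv x)"
      by (intro continuous_on_subset[OF orbit_conv_continuous[of "t/2" "t+1"]]) auto
    then show "isCont (orbit_conv x) t"
      using t by (simp add: continuous_on_eq_continuous_at)
  qed
  have der: "(int_conv x has_vector_derivative orbit_conv x t) (at t)" if "0 < t" for t
    by (rule has_vector_derivative_of_increment[of 0 "t + 1"])
      (use that int_conv_increment in \<open>auto intro: continuous_on_subset[OF cont]\<close>)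
  have zero: "int_conv x 0 = 0" by (simp add: int_conv_def)
  have "continuous_on {0..} (int_conv x)"
    unfolding continuous_on_eq_continuous_within
  proof
    fix t :: real assume "t \<in> {0..}"
    then consider "t = 0" | "0 < t" by fastforce
    then show "continuous (at t within {0..}) (int_conv x)"
    proof cases
      case 1
      have "(\<kappa> \<longlongrightarrow> \<kappa> 0) (at 0 within {0..})"
        using \<kappa>_continuous by (simp add: continuous_on_def)
      then have "((\<lambda>t. \<kappa> t * norm x * \<kappa> t) \<longlongrightarrow> \<kappa> 0 * norm x * \<kappa> 0) (at 0 within {0..})"
        by (intro tendsto_intros)
      then have "((\<lambda>t. \<kappa> t * norm x * \<kappa> t) \<longlongrightarrow> 0) (at 0 within {0..})"
        by (simp add: \<kappa>_0)
      then have "(int_conv x \<longlongrightarrow> 0) (at 0 within {0..})"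
        by (rule Lim_null_comparison[rotated]) (simp add: norm_int_conv)
      then show ?thesis by (simp add: 1 continuous_within zero)
    next
      case 2
      show ?thesis
        by (rule continuous_at_imp_continuous_at_within[OF has_vector_derivative_continuous[OF der[OF 2]]])
    qed
  qed
  note * = cont_loc_integrableI_primitive[OF cont this der]
  show "cont_loc_integrable (orbit_conv x)" using *(1) by blast
  show "integral {0..N} (orbit_conv x) = int_conv x N" if "0 \<le> N"
    using *(2)[OF _ that] by (simp add: integral_unique zero)
qed

text \<open>The convolution theorem at l = 0. \<open>int_conv x N\<close> is compared with R (P N
  x), the integral of R (S s x); the operator error at s is at most the tail L - \<kappa>(N - s).
  For s \<le> N/2 this tail is small, and on s > N/2 the mass of \<open>m\<close> is small.\<close>

theorem integral_orbit_conv_tendsto: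
  assumes bdd: "\<And>T. \<kappa> T \<le> C" and R: "bounded_linear R"
    and lim: "\<And>y. ((\<lambda>T. blinfun_apply (P T) y) \<longlongrightarrow> R y) at_top"
  shows "((\<lambda>N. integral {0..N} (orbit_conv x)) \<longlongrightarrow> R (R x)) at_top"
proof -
  \<comment> \<open>The total mass of the majorant, finite by \<open>bdd\<close>; as \<kappa>
    increases, it is also the limit of \<kappa>.\<close>
  define L where "L = (SUP T. \<kappa> T)"
  have bdd': "bdd_above (range \<kappa>)" using bdd by (intro bdd_aboveI[of _ C]) auto
  have \<kappa>L: "\<kappa> T \<le> L" for T unfolding L_def using bdd' by (rule cSUP_upper2) auto
  have L0: "0 \<le> L" using \<kappa>L[of 0] by (simp add: \<kappa>_0)
  have "(\<kappa> \<longlongrightarrow> L) at_top"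
  proof (rule order_tendstoI)
    fix a assume "a < L"
    then obtain T where "a < \<kappa> T" unfolding L_def using less_cSUP_iff[OF _ bdd'] by auto
    then show "\<forall>\<^sub>F t in at_top. a < \<kappa> t"
      unfolding eventually_at_top_linorder using \<kappa>_mono less_le_trans by blast
  next
    show "\<forall>\<^sub>F t in at_top. \<kappa> t < a" if "L < a" for a
      using le_less_trans[OF \<kappa>L that] by simp
  qed
  then have "((\<lambda>N. \<kappa> (N / 2)) \<longlongrightarrow> L) at_top"
    by (rule filterlim_compose) real_asymp
  then have "((\<lambda>N. 2 * L * norm x * (L - \<kappa> (N / 2))) \<longlongrightarrow> 2 * L * norm x * (L - L)) at_top"
    by (intro tendsto_intros)
  then have lim0: "((\<lambda>N. 2 * L * norm x * (L - \<kappa> (N / 2))) \<longlongrightarrow> 0) at_top" by simp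
  have tail: "norm (R y - blinfun_apply (P T) y) \<le> (L - \<kappa> T) * norm y" if "0 \<le> T" for T y
  proof (rule tendsto_upperbound)
    show "((\<lambda>M. norm (blinfun_apply (P M) y - blinfun_apply (P T) y)) \<longlongrightarrow> norm (R y - blinfun_apply (P T) y)) at_top"
      by (intro tendsto_intros lim)
    have "norm (blinfun_apply (P M) y - blinfun_apply (P T) y) \<le> (L - \<kappa> T) * norm y" if M: "T \<le> M" for M
    proof -
      have I: "(\<lambda>s. blinfun_apply (S s) y) integrable_on {0..M}"
        using orbit by (simp add: cont_loc_integrable_def)
      have IT: "(\<lambda>s. blinfun_apply (S s) y) integrable_on {T..M}"
        using \<open>0 \<le> T\<close> by (intro integrable_subinterval_real[OF I]) auto
      have mT: "m integrable_on {T..M}"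
        using \<open>0 \<le> T\<close> by (intro integrable_subinterval_real[OF m_integrable[of M]]) auto
      have "blinfun_apply (P M) y - blinfun_apply (P T) y = integral {T..M} (\<lambda>s. blinfun_apply (S s) y)"
        using Henstock_Kurzweil_Integration.integral_combine[OF \<open>0 \<le> T\<close> M I] by (simp add: P_apply algebra_simps)
      also have "norm \<dots> \<le> integral {T..M} m * norm y"
        by (rule norm_integral_le_interior[OF IT has_integral_mult_left[OF integrable_integral[OF mT]] norm_orbit])
          (use \<open>0 \<le> T\<close> in auto)
      also have "integral {T..M} m = \<kappa> M - \<kappa> T"
        using Henstock_Kurzweil_Integration.integral_combine[OF \<open>0 \<le> T\<close> M m_integrable] by (simp add: \<kappa>_def)
      also have "(\<kappa> M - \<kappa> T) * norm y \<le> (L - \<kappa> T) * norm y"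
        by (intro mult_right_mono diff_right_mono \<kappa>L) auto
      finally show ?thesis .
    qed
    then show "\<forall>\<^sub>F M in at_top. norm (blinfun_apply (P M) y - blinfun_apply (P T) y) \<le> (L - \<kappa> T) * norm y"
      unfolding eventually_at_top_linorder by blast
  qed simp
  have est: "norm (R (blinfun_apply (P N) x) - int_conv x N) \<le> 2 * L * norm x * (L - \<kappa> (N / 2))" if N: "0 \<le> N" for N
  proof -
    define g where "g s = (if s \<le> N / 2 then m s else 0)" for s
    have g: "(g has_integral \<kappa> (N / 2)) {0..N}"
      unfolding g_def using truncated_majorant[of "N / 2" N] N by (simp add: min_absorb2)
    have I: "(\<lambda>s. blinfun_apply (S s) x) integrable_on {0..N}"
      using orbit by (simp add: cont_loc_integrable_def)
    have IR: "(\<lambda>s. R (blinfun_apply (S s) x)) integrable_on {0..N}"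
      using integrable_linear[OF I R] by (simp add: o_def)
    let ?d = "\<lambda>s. R (blinfun_apply (S s) x) - blinfun_apply (P (N - s)) (blinfun_apply (S s) x)"
    have "norm (integral {0..N} ?d) \<le> (L - \<kappa> (N / 2)) * norm x * \<kappa> N + L * norm x * (\<kappa> N - \<kappa> (N / 2))"
    proof (rule norm_integral_le_interior)
      show "((\<lambda>s. (L - \<kappa> (N / 2)) * norm x * m s + L * norm x * (m s - g s)) has_integral
          (L - \<kappa> (N / 2)) * norm x * \<kappa> N + L * norm x * (\<kappa> N - \<kappa> (N / 2))) {0..N}"
        by (intro has_integral_add has_integral_mult_right has_integral_diff g \<kappa>_has_integral)
      show "norm (?d s) \<le> (L - \<kappa> (N / 2)) * norm x * m s + L * norm x * (m s - g s)" if s: "0 < s" "s < N" for s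
      proof -
        have "norm (?d s) \<le> (L - \<kappa> (N - s)) * norm (blinfun_apply (S s) x)"
          using s by (intro tail) auto
        also have "\<dots> \<le> (L - \<kappa> (N - s)) * (m s * norm x)"
          using s \<kappa>L by (intro mult_left_mono norm_orbit) auto
        also have "\<dots> \<le> (L - \<kappa> (N / 2)) * norm x * m s + L * norm x * (m s - g s)"
        proof (cases "s \<le> N / 2")
          case True
          then have "(L - \<kappa> (N - s)) * (m s * norm x) \<le> (L - \<kappa> (N / 2)) * (m s * norm x)"
            by (intro mult_right_mono diff_left_mono \<kappa>_mono mult_nonneg_nonneg m_nonneg) auto
          then show ?thesis using True by (simp add: g_def mult_ac)
        next
          case False
          have "(L - \<kappa> (N - s)) * (m s * norm x) \<le> L * (m s * norm x)"
            using \<kappa>_nonneg[of "N - s"] by (intro mult_right_mono mult_nonneg_nonneg m_nonneg) auto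
          moreover have "0 \<le> (L - \<kappa> (N / 2)) * norm x * m s"
            using \<kappa>L by (intro mult_nonneg_nonneg m_nonneg) auto
          ultimately show ?thesis using False by (simp add: g_def mult_ac)
        qed
        finally show ?thesis .
      qed
    qed (intro integrable_diff IR P_S_integrable)
    also have "\<dots> \<le> (L - \<kappa> (N / 2)) * norm x * L + L * norm x * (L - \<kappa> (N / 2))"
      using \<kappa>L L0 by (intro add_mono mult_left_mono mult_nonneg_nonneg diff_right_mono) auto
    also have "\<dots> = 2 * L * norm x * (L - \<kappa> (N / 2))" by (simp add: algebra_simps)
    also have "integral {0..N} ?d = R (blinfun_apply (P N) x) - int_conv x N"
      using integral_linear[OF I R]
      by (simp add: Henstock_Kurzweil_Integration.integral_diff IR P_S_integrable int_conv_def P_apply[of N x] o_def)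
    finally show ?thesis .
  qed
  have "((\<lambda>N. R (blinfun_apply (P N) x) - int_conv x N) \<longlongrightarrow> 0) at_top"
    by (rule Lim_null_comparison[OF _ lim0])
      (use est in \<open>auto simp: eventually_at_top_linorder intro!: exI[of _ 0]\<close>)
  moreover have "((\<lambda>N. R (blinfun_apply (P N) x)) \<longlongrightarrow> R (R x)) at_top"
    by (intro bounded_linear.tendsto[OF R] lim)
  ultimately have "((\<lambda>N. R (blinfun_apply (P N) x) - (R (blinfun_apply (P N) x) - int_conv x N)) \<longlongrightarrow> R (R x) - 0) at_top"
    by (intro tendsto_diff)
  then have "(int_conv x \<longlongrightarrow> R (R x)) at_top" by simp
  then show ?thesis
    by (rule Lim_transform_eventually)
      (auto simp: eventually_at_top_linorder integral_orbit_conv intro!: exI[of _ 0])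
qed

end

section \<open>Laplace transforms of the orbit convolution and of t u(t)\<close>

text \<open>Nonnegativity turns Henstock-Kurzweil integrability of \<open>m\<close> into absolute
  integrability, which survives multiplication by a bounded measurable factor.\<close>

lemma exp_times_integrable:
  fixes m :: "real \<Rightarrow> real"
  assumes m: "m integrable_on {0..T}" and "\<And>t. 0 \<le> m t"
  shows "(\<lambda>t. exp (c * t) * m t) integrable_on {0..T}"
proof -
  have "m absolutely_integrable_on {0..T}"
    using assms by (intro nonnegative_absolutely_integrable_1) auto
  moreover have cont: "continuous_on {0..T} (\<lambda>t. exp (c * t))"
    by (intro continuous_intros)
  moreover have "bounded ((\<lambda>t. exp (c * t)) ` {0..T})"
    by (intro compact_imp_bounded compact_continuous_image cont) auto
  moreover have "(\<lambda>t. exp (c * t)) \<in> borel_measurable (lebesgue_on {0..T})"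
    by (intro continuous_imp_measurable_on_sets_lebesgue cont) auto
  ultimately have "(\<lambda>t. exp (c * t) * m t) absolutely_integrable_on {0..T}"
    by (intro absolutely_integrable_bounded_measurable_product_real) auto
  then show ?thesis by (rule set_lebesgue_integral_eq_integral(1))
qed

text \<open>The integral over an unbounded set is a limit over boxes. On the box {-N..N},
  integrability over {0..N} identifies the witness provided by the definition with the truncated
  integral.\<close>

lemma tendsto_integral_half_line:
  fixes f :: "real \<Rightarrow> 'a::banach"
  assumes I: "(f has_integral I) {0<..}" and f: "\<And>N. f integrable_on {0..N}"
  shows "((\<lambda>N. integral {0..N} f) \<longlongrightarrow> I) at_top"
proof (rule tendstoI)
  fix e :: real assume e: "0 < e"
  have "\<not> (\<exists>a b. {0<..} = cbox a (b::real))"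
  proof
    assume "\<exists>a b. {0<..} = cbox a (b::real)"
    then have "bounded {0::real<..}" by (metis bounded_cbox)
    then obtain B where B: "\<forall>x\<in>{0::real<..}. norm x \<le> B" by (auto simp: bounded_iff)
    have "\<bar>B\<bar> + 1 \<in> {0::real<..}" by auto
    with B have "norm (\<bar>B\<bar> + 1) \<le> B" by blast
    then show False by simp
  qed
  then obtain B where B: "0 < B" "\<And>a b. ball 0 B \<subseteq> cbox a b \<Longrightarrow>
      \<exists>z. ((\<lambda>x. if x \<in> {0<..} then f x else 0) has_integral z) (cbox a b) \<and> norm (z - I) < e"
    using has_integral_altD[OF I _ e] by metis
  have "dist (integral {0..N} f) I < e" if N: "B \<le> N" for N
  proof -
    have "ball 0 B \<subseteq> cbox (-N) N" using N by (auto simp: dist_norm)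
    then obtain z where z: "((\<lambda>x. if x \<in> {0<..} then f x else 0) has_integral z) {-N..N}" "norm (z - I) < e"
      using B(2)[of "-N" N] by auto
    have "((\<lambda>x. if x \<in> {0..N} then f x else 0) has_integral integral {0..N} f) {-N..N}"
      by (subst has_integral_restrict) (use f[of N] B N in \<open>auto intro: integrable_integral\<close>)
    then have "((\<lambda>x. if x \<in> {0<..} then f x else 0) has_integral integral {0..N} f) {-N..N}"
      by (rule has_integral_spike_finite[of "{0}", rotated 2]) auto
    with z have "z = integral {0..N} f" using has_integral_unique by blast
    with z show ?thesis by (simp add: dist_norm)
  qed
  then show "\<forall>\<^sub>F N in at_top. dist (integral {0..N} f) I < e"
    unfolding eventually_at_top_linorder by blast
qed

text \<open>Writing t = T - (T - t) reduces the claim to \<open>f\<close> itself and to the weight T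
  - t of the double primitive.\<close>

lemma cont_loc_integrable_times_id:
  fixes f :: "real \<Rightarrow> 'a::banach"
  assumes f: "cont_loc_integrable f"
  shows "cont_loc_integrable (\<lambda>t. t *\<^sub>R f t)"
proof -
  have "(\<lambda>t. t *\<^sub>R f t) integrable_on {0..T}" for T
  proof (cases "0 \<le> T")
    case True
    have "(\<lambda>t. T *\<^sub>R f t - (T - t) *\<^sub>R f t) integrable_on {0..T}"
      using integral_primitive[OF f True] f unfolding cont_loc_integrable_def
      by (intro integrable_diff integrable_cmul) auto
    then show ?thesis by (simp add: scaleR_diff_left)
  qed (simp add: integrable_on_empty)
  with f show ?thesis
    by (auto simp: cont_loc_integrable_def intro!: continuous_intros)
qed

text \<open>A Taylor remainder in l for the kernel exp (- l t): the difference quotient misses the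
  derivative by at most h t^2 exp (- l t). The factor t^2 is absorbed into exp (d t) at the price 2
  / d^2, giving up the part d of the decay rate.\<close>

lemma exp_second_order:
  fixes h d l t :: real
  assumes "0 < h" "0 < d" "0 \<le> t"
  shows "\<bar>exp (- l * t) * t + (exp (- (l + h) * t) - exp (- l * t)) / h\<bar> \<le> h * (2 / d\<^sup>2) * exp (- (l - d) * t)"
proof -
  define y where "y = h * t"
  have y: "0 \<le> y" using assms by (simp add: y_def)
  have "exp (- y) \<le> 1 - y + y\<^sup>2"
  proof -
    have "exp (- y) \<le> 1 / (1 + y)"
      using exp_ge_add_one_self[of y] y by (simp add: exp_minus field_simps)
    also have "\<dots> \<le> 1 - y + y\<^sup>2"
      using y by (simp add: field_simps power2_eq_square)
    finally show ?thesis .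
  qed
  moreover have "1 - y \<le> exp (- y)" using exp_ge_add_one_self[of "-y"] by simp
  ultimately have "\<bar>exp (- y) - 1 + y\<bar> \<le> y\<^sup>2" by simp
  then have "\<bar>exp (- y) - 1 + y\<bar> / h \<le> y\<^sup>2 / h"
    using assms by (simp add: divide_right_mono)
  also have "y\<^sup>2 / h = h * t\<^sup>2" using assms by (simp add: y_def power2_eq_square)
  also have "h * t\<^sup>2 \<le> h * (2 / d\<^sup>2 * exp (d * t))"
  proof (intro mult_left_mono)
    have "1 + d * t + (d * t)\<^sup>2 / 2 \<le> exp (d * t)"
      using assms by (intro exp_lower_Taylor_quadratic) auto
    moreover have "0 \<le> d * t" using assms by simp
    ultimately have "(d * t)\<^sup>2 / 2 \<le> exp (d * t)" by linarith
    then show "t\<^sup>2 \<le> 2 / d\<^sup>2 * exp (d * t)"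
      using assms by (simp add: field_simps power_mult_distrib)
  qed (use assms in simp)
  finally have le: "\<bar>exp (- y) - 1 + y\<bar> / h \<le> h * (2 / d\<^sup>2 * exp (d * t))" .
  have "exp (- l * t) * t + (exp (- (l + h) * t) - exp (- l * t)) / h = exp (- l * t) * ((exp (- y) - 1 + y) / h)"
    using assms by (simp add: y_def field_simps exp_add[symmetric])
  then have "\<bar>exp (- l * t) * t + (exp (- (l + h) * t) - exp (- l * t)) / h\<bar> = exp (- l * t) * (\<bar>exp (- y) - 1 + y\<bar> / h)"
    using assms by (simp add: abs_mult)
  also have "\<dots> \<le> exp (- l * t) * (h * (2 / d\<^sup>2 * exp (d * t)))"
    by (intro mult_left_mono le) auto
  also have "\<dots> = h * (2 / d\<^sup>2) * (exp (- l * t) * exp (d * t))" by (simp add: mult_ac)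
  also have "exp (- l * t) * exp (d * t) = exp (- (l - d) * t)"
    by (simp add: exp_add[symmetric] algebra_simps)
  finally show ?thesis .
qed

context majorized_family begin

text \<open>Since exp (- l (t - s)) exp (- l s) = exp (- l t), convolving the weighted family is
  weighting the convolution. A Laplace transform at l thus becomes a total integral for a family of
  the same kind.\<close>

lemma weighted: "majorized_family (\<lambda>t. exp (- l * t) *\<^sub>R S t) (\<lambda>t. exp (- l * t) * m t)"
proof
  have "continuous_on {0<..} (\<lambda>t. exp (- l * t))" by (intro continuous_intros)
  then show "strongly_continuous (\<lambda>t. exp (- l * t) *\<^sub>R S t)"
    using strong unfolding strongly_continuous_def blinfun.scaleR_left
    by (auto intro!: continuous_on_scaleR)
  show "(\<lambda>t. exp (- l * t) * m t) integrable_on {0..T}" for T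
    by (intro exp_times_integrable m_integrable m_nonneg)
qed (auto simp: m_nonneg bound)

lemma laplace_orbit_conv:
  assumes C: "\<And>N. integral {0..N} (\<lambda>t. exp (- l * t) * m t) \<le> C" and R: "bounded_linear R"
    and lim: "\<And>y. laplace_to (\<lambda>t. blinfun_apply (S t) y) l (R y)"
  shows "laplace_to (orbit_conv x) l (R (R x))"
proof -
  interpret w: majorized_family "\<lambda>t. exp (- l * t) *\<^sub>R S t" "\<lambda>t. exp (- l * t) * m t"
    by (rule weighted)
  have eq: "w.orbit_conv x = (\<lambda>t. exp (- l * t) *\<^sub>R orbit_conv x t)"
  proof
    fix t
    have "w.orbit_conv x t = integral {0..t} (\<lambda>s. exp (- l * t) *\<^sub>R blinfun_apply (S (t - s)) (blinfun_apply (S s) x))"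
      unfolding w.orbit_conv_def
      by (intro integral_cong) (simp add: blinfun.scaleR_left blinfun.scaleR_right exp_add[symmetric] algebra_simps)
    then show "w.orbit_conv x t = exp (- l * t) *\<^sub>R orbit_conv x t" by (simp add: orbit_conv_def)
  qed
  have "((\<lambda>N. integral {0..N} (w.orbit_conv x)) \<longlongrightarrow> R (R x)) at_top"
  proof (rule w.integral_orbit_conv_tendsto[OF _ R])
    show "w.\<kappa> T \<le> C" for T unfolding w.\<kappa>_def by (rule C)
    show "((\<lambda>T. blinfun_apply (w.P T) y) \<longlongrightarrow> R y) at_top" for y
      using lim[of y] unfolding w.P_apply laplace_to_def blinfun.scaleR_left .
  qed
  then show ?thesis by (simp only: laplace_to_def eq)
qed

text \<open>The bound is uniform in l' \<ge> l because the weight only decreases. It later bounds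
  the resolvents applied to x along a half line, from which their continuity in l is
  deduced.\<close>

lemma norm_laplace_le:
  assumes C: "\<And>N. integral {0..N} (\<lambda>t. exp (- l * t) * m t) \<le> C" and l: "l \<le> l'"
    and lim: "laplace_to (\<lambda>t. blinfun_apply (S t) x) l' y"
  shows "norm y \<le> C * norm x"
proof (rule tendsto_upperbound)
  show "((\<lambda>N. norm (integral {0..N} (\<lambda>t. exp (- l' * t) *\<^sub>R blinfun_apply (S t) x))) \<longlongrightarrow> norm y) at_top"
    using lim unfolding laplace_to_def by (rule tendsto_norm)
  have "norm (integral {0..N} (\<lambda>t. exp (- l' * t) *\<^sub>R blinfun_apply (S t) x)) \<le> C * norm x" for N
  proof -
    have "norm (integral {0..N} (\<lambda>t. exp (- l' * t) *\<^sub>R blinfun_apply (S t) x))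
        \<le> integral {0..N} (\<lambda>t. exp (- l * t) * m t) * norm x"
    proof (rule norm_integral_le_interior)
      show "(\<lambda>t. exp (- l' * t) *\<^sub>R blinfun_apply (S t) x) integrable_on {0..N}"
        by (rule cont_loc_integrableD[OF cont_loc_integrable_exp[OF orbit]])
      show "((\<lambda>t. exp (- l * t) * m t * norm x) has_integral integral {0..N} (\<lambda>t. exp (- l * t) * m t) * norm x) {0..N}"
        by (intro has_integral_mult_left integrable_integral exp_times_integrable m_integrable m_nonneg)
      show "norm (exp (- l' * t) *\<^sub>R blinfun_apply (S t) x) \<le> exp (- l * t) * m t * norm x" if "0 < t" for t
      proof -
        have "exp (- l' * t) * norm (blinfun_apply (S t) x) \<le> exp (- l * t) * (m t * norm x)"
          using l that by (intro mult_mono norm_orbit) (auto simp: mult_right_mono)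
        then show ?thesis by (simp add: mult_ac)
      qed
    qed
    also have "\<dots> \<le> C * norm x" using C by (intro mult_right_mono) auto
    finally show ?thesis .
  qed
  then show "\<forall>\<^sub>F N in at_top. norm (integral {0..N} (\<lambda>t. exp (- l' * t) *\<^sub>R blinfun_apply (S t) x)) \<le> C * norm x"
    by simp
qed simp

text \<open>Differentiation under the integral sign. On {0..N} the difference quotient and the
  derivative differ by h times a constant independent of \<open>N\<close>, so one fixed small
  \<open>h\<close> serves all large \<open>N\<close>. The gap \<open>l - l\<^sub>1\<close> is the
  decay sacrificed in \<open>exp_second_order\<close>.\<close>

lemma laplace_times_id:
  assumes C: "\<And>N. integral {0..N} (\<lambda>t. exp (- l\<^sub>1 * t) * m t) \<le> C" and l: "l\<^sub>1 < l"
    and lap: "\<And>l'. l \<le> l' \<Longrightarrow> laplace_to (\<lambda>t. blinfun_apply (S t) x) l' (\<phi> l')"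
    and der: "((\<lambda>h. (\<phi> (l + h) - \<phi> l) /\<^sub>R h) \<longlongrightarrow> - y) (at_right 0)"
  shows "laplace_to (\<lambda>t. t *\<^sub>R blinfun_apply (S t) x) l y"
proof -
  define d where "d = l - l\<^sub>1"
  have d: "0 < d" using l by (simp add: d_def)
  define u where "u t = blinfun_apply (S t) x" for t
  have u: "cont_loc_integrable u" unfolding u_def by (rule orbit)
  have I: "(\<lambda>t. exp (- l * t) *\<^sub>R u t) integrable_on {0..N}" for l N
    by (rule cont_loc_integrableD[OF cont_loc_integrable_exp[OF u]])
  have It: "(\<lambda>t. exp (- l * t) *\<^sub>R (t *\<^sub>R u t)) integrable_on {0..N}" for N
    by (rule cont_loc_integrableD[OF cont_loc_integrable_exp[OF cont_loc_integrable_times_id[OF u]]])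
  define X where "X l N = integral {0..N} (\<lambda>t. exp (- l * t) *\<^sub>R u t)" for l N
  define Y where "Y N = integral {0..N} (\<lambda>t. exp (- l * t) *\<^sub>R (t *\<^sub>R u t))" for N
  have est: "norm (Y N + (X (l + h) N - X l N) /\<^sub>R h) \<le> h * (2 / d\<^sup>2 * C * norm x)" if h: "0 < h" for h N
  proof -
    let ?c = "\<lambda>t. exp (- l * t) * t + (exp (- (l + h) * t) - exp (- l * t)) / h"
    have Id: "(\<lambda>t. (exp (- (l + h) * t) *\<^sub>R u t - exp (- l * t) *\<^sub>R u t) /\<^sub>R h) integrable_on {0..N}"
      by (intro integrable_cmul integrable_diff I)
    have split: "?c t *\<^sub>R u t = exp (- l * t) *\<^sub>R (t *\<^sub>R u t) + (exp (- (l + h) * t) *\<^sub>R u t - exp (- l * t) *\<^sub>R u t) /\<^sub>R h" for t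
      by (simp add: scaleR_add_left scaleR_diff_left[symmetric] divide_inverse mult.commute)
    have Ic: "(\<lambda>t. ?c t *\<^sub>R u t) integrable_on {0..N}"
      unfolding split by (intro integrable_add It Id)
    have "Y N + (X (l + h) N - X l N) /\<^sub>R h = integral {0..N} (\<lambda>t. ?c t *\<^sub>R u t)"
      unfolding split
      by (subst Henstock_Kurzweil_Integration.integral_add[OF It Id])
        (simp only: Y_def X_def integral_cmul Henstock_Kurzweil_Integration.integral_diff[OF I I])
    also have "norm \<dots> \<le> h * (2 / d\<^sup>2) * norm x * integral {0..N} (\<lambda>t. exp (- l\<^sub>1 * t) * m t)"
    proof (rule norm_integral_le_interior[OF Ic])
      show "((\<lambda>t. h * (2 / d\<^sup>2) * norm x * (exp (- l\<^sub>1 * t) * m t)) has_integral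
          h * (2 / d\<^sup>2) * norm x * integral {0..N} (\<lambda>t. exp (- l\<^sub>1 * t) * m t)) {0..N}"
        by (intro has_integral_mult_right integrable_integral exp_times_integrable m_integrable m_nonneg)
      show "norm (?c t *\<^sub>R u t) \<le> h * (2 / d\<^sup>2) * norm x * (exp (- l\<^sub>1 * t) * m t)" if t: "0 < t" for t
      proof -
        have "\<bar>?c t\<bar> * norm (u t) \<le> (h * (2 / d\<^sup>2) * exp (- (l - d) * t)) * (m t * norm x)"
          unfolding u_def using t h d
          by (intro mult_mono exp_second_order norm_orbit) auto
        then show ?thesis by (simp add: d_def mult_ac)
      qed
    qed
    also have "\<dots> \<le> h * (2 / d\<^sup>2) * norm x * C"
      using h by (intro mult_left_mono C) auto
    finally show ?thesis by (simp add: mult_ac)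
  qed
  have X: "(X l' \<longlongrightarrow> \<phi> l') at_top" if "l \<le> l'" for l'
    using lap[OF that] unfolding laplace_to_def X_def u_def by simp
  have "(Y \<longlongrightarrow> y) at_top"
  proof (rule tendstoI)
    fix e :: real assume e: "0 < e"
    have "((\<lambda>h. norm ((\<phi> (l + h) - \<phi> l) /\<^sub>R h + y) + h * (2 / d\<^sup>2 * C * norm x))
        \<longlongrightarrow> norm (- y + y) + 0 * (2 / d\<^sup>2 * C * norm x)) (at_right 0)"
      by (intro tendsto_intros der)
    then have "\<forall>\<^sub>F h in at_right 0. norm ((\<phi> (l + h) - \<phi> l) /\<^sub>R h + y) + h * (2 / d\<^sup>2 * C * norm x) < e"
      by (rule order_tendstoD(2)) (use e in simp)
    then have "\<forall>\<^sub>F h in at_right 0. 0 < h \<and> norm ((\<phi> (l + h) - \<phi> l) /\<^sub>R h + y) + h * (2 / d\<^sup>2 * C * norm x) < e"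
      using eventually_at_right_less[of "0::real"] by eventually_elim simp
    then obtain h where h: "0 < h" "norm ((\<phi> (l + h) - \<phi> l) /\<^sub>R h + y) + h * (2 / d\<^sup>2 * C * norm x) < e"
      using eventually_happens'[OF trivial_limit_at_right_real] by blast
    have "((\<lambda>N. norm ((X (l + h) N - X l N) /\<^sub>R h + y) + h * (2 / d\<^sup>2 * C * norm x)) \<longlongrightarrow>
        norm ((\<phi> (l + h) - \<phi> l) /\<^sub>R h + y) + h * (2 / d\<^sup>2 * C * norm x)) at_top"
      using h(1) by (intro tendsto_intros X) auto
    then have "\<forall>\<^sub>F N in at_top. norm ((X (l + h) N - X l N) /\<^sub>R h + y) + h * (2 / d\<^sup>2 * C * norm x) < e"
      by (rule order_tendstoD(2)) (rule h(2))
    then show "\<forall>\<^sub>F N in at_top. dist (Y N) y < e"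
    proof eventually_elim
      case (elim N)
      have "Y N - y = (Y N + (X (l + h) N - X l N) /\<^sub>R h) - ((X (l + h) N - X l N) /\<^sub>R h + y)"
        by simp
      then have "norm (Y N - y) \<le> norm (Y N + (X (l + h) N - X l N) /\<^sub>R h) + norm ((X (l + h) N - X l N) /\<^sub>R h + y)"
        by (metis norm_triangle_ineq4)
      with est[OF h(1), of N] elim show ?case by (simp add: dist_norm)
    qed
  qed
  then show ?thesis unfolding laplace_to_def Y_def u_def .
qed

end

section \<open>Resolvents\<close>

text \<open>The majorant is norm (S t) on (0,1], where integrability is given, and the exponential
  bound beyond. For l > w its weighted mass is at most the weighted integral over {0..1} plus M / (l
  - w).\<close>

lemma exponentially_bounded_imp_majorized:
  fixes S :: "real \<Rightarrow> 'a::banach \<Rightarrow>\<^sub>L 'a"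
  assumes S: "strongly_continuous S" and E: "exponentially_bounded S"
  obtains m w where "majorized_family S m"
    "\<And>l. w < l \<Longrightarrow> \<exists>C. \<forall>N. integral {0..N} (\<lambda>t. exp (- l * t) * m t) \<le> C"
proof -
  obtain M w where M: "0 < M" "\<And>t. 1 \<le> t \<Longrightarrow> norm (S t) \<le> M * exp (w * t)"
    using E unfolding exponentially_bounded_def by blast
  have near: "(\<lambda>t. norm (S t)) integrable_on {0<..1}"
    using E unfolding exponentially_bounded_def by blast
  define m where "m t = (if t \<le> 0 then 0 else if t \<le> 1 then norm (S t) else M * exp (w * t))" for t
  have m0: "0 \<le> m t" for t using M(1) by (simp add: m_def)
  have near': "m integrable_on {0..1}"
  proof -
    have "m integrable_on {0<..1}"
      by (rule integrable_eq[OF near]) (simp add: m_def)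
    then show ?thesis
      by (rule integrable_spike_set) (auto intro: negligible_subset[of "{0}"])
  qed
  have far: "m integrable_on {1..T}" for T
  proof (rule integrable_spike_finite[of "{1}" _ _ "\<lambda>t. M * exp (w * t)"])
    show "(\<lambda>t. M * exp (w * t)) integrable_on {1..T}"
      by (intro integrable_continuous_real continuous_intros)
  qed (auto simp: m_def)
  have mi: "m integrable_on {0..T}" for T
  proof -
    have "m integrable_on {0..max 1 T}"
      by (rule Henstock_Kurzweil_Integration.integrable_combine[of 0 1]) (auto intro: near' far)
    then show ?thesis by (rule integrable_subinterval_real) auto
  qed
  interpret majorized_family S m
  proof
    show "norm (S t) \<le> m t" if "0 < t" for t
      using that M(2) by (simp add: m_def)
  qed (auto simp: S m0 mi)
  have "\<exists>C. \<forall>N. integral {0..N} (\<lambda>t. exp (- l * t) * m t) \<le> C" if l: "w < l" for l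
  proof -
    define f where "f t = exp (- l * t) * m t" for t
    have fi: "f integrable_on {0..T}" for T
      unfolding f_def by (intro exp_times_integrable mi m0)
    have f0: "0 \<le> f t" for t by (simp add: f_def m0)
    define d where "d = l - w"
    have d: "0 < d" using l by (simp add: d_def)
    have bound: "integral {0..N} f \<le> integral {0..1} f + M / d" for N
    proof -
      define T where "T = max 1 N"
      have "integral {0..N} f \<le> integral {0..T} f"
        by (intro integral_subset_le fi f0 ballI) (auto simp: T_def)
      also have "\<dots> = integral {0..1} f + integral {1..T} f"
        using Henstock_Kurzweil_Integration.integral_combine[of 0 1 T f] fi by (simp add: T_def)
      also have "integral {1..T} f = - (M / d) * exp (- d * T) - (- (M / d) * exp (- d * 1))"
      proof (intro integral_unique has_integral_spike_finite[of "{1}" _ f "\<lambda>t. M * exp (- d * t)"])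
        show "f t = M * exp (- d * t)" if "t \<in> {1..T} - {1}" for t
          using that by (simp add: f_def m_def d_def exp_add[symmetric] algebra_simps)
        show "((\<lambda>t. M * exp (- d * t)) has_integral - (M / d) * exp (- d * T) - (- (M / d) * exp (- d * 1))) {1..T}"
          using d by (intro fundamental_theorem_of_calculus)
            (auto simp: T_def has_real_derivative_iff_has_vector_derivative[symmetric]
              intro!: derivative_eq_intros)
      qed simp
      also have "\<dots> \<le> M / d"
      proof -
        have "M / d * exp (- d) \<le> M / d * 1"
          using d M(1) by (intro mult_left_mono) auto
        moreover have "0 \<le> M / d * exp (- d * T)"
          using d M(1) by simp
        ultimately show ?thesis by simp
      qed
      finally show ?thesis by simp
    qed
    then show ?thesis unfolding f_def by blast
  qed
  then show thesis by (rule that[OF majorized_family_axioms])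
qed

section \<open>The resolvent along the curve l powr \<alpha>\<close>

lemma resolvent_properties:
  assumes "\<mu> \<in> resolvent_set D A"
  shows bounded_linear_resolvent: "bounded_linear (resolvent D A \<mu>)"
    and resolvent_in_domain: "resolvent D A \<mu> y \<in> D"
    and resolvent_right_inverse: "\<mu> *\<^sub>C resolvent D A \<mu> y - A (resolvent D A \<mu> y) = y"
    and resolvent_left_inverse: "z \<in> D \<Longrightarrow> resolvent D A \<mu> (\<mu> *\<^sub>C z - A z) = z"
proof -
  show "bounded_linear (resolvent D A \<mu>)" using assms by (simp add: resolvent_set_def)
  have b: "bij_betw (\<lambda>y. \<mu> *\<^sub>C y - A y) D UNIV" using assms by (simp add: resolvent_set_def)
  show "resolvent D A \<mu> y \<in> D"
    unfolding resolvent_def using b by (intro the_inv_into_into) (auto simp: bij_betw_def)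
  show "\<mu> *\<^sub>C resolvent D A \<mu> y - A (resolvent D A \<mu> y) = y"
    unfolding resolvent_def using f_the_inv_into_f_bij_betw[OF b, of y] by simp
  show "z \<in> D \<Longrightarrow> resolvent D A \<mu> (\<mu> *\<^sub>C z - A z) = z"
    unfolding resolvent_def using the_inv_into_f_f[of "\<lambda>y. \<mu> *\<^sub>C y - A y" D z] b
    by (simp add: bij_betw_def)
qed

text \<open>With z the resolvent at q of y, the equation q z - A z = y becomes p z - A z = y - (q -
  p) z; the resolvent at p is applied to it.\<close>

lemma resolvent_identity:
  assumes p: "complex_of_real p \<in> resolvent_set D A" and q: "complex_of_real q \<in> resolvent_set D A"
  shows "resolvent D A p y - resolvent D A q y = (q - p) *\<^sub>R resolvent D A p (resolvent D A q y)"
proof -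
  define z where "z = resolvent D A q y"
  have z: "z \<in> D" unfolding z_def by (rule resolvent_in_domain[OF q])
  have "q *\<^sub>R z - A z = y"
    using resolvent_right_inverse[OF q, of y] by (simp add: z_def scaleC_of_real)
  then have "p *\<^sub>R z - A z = y - (q - p) *\<^sub>R z" by (auto simp: algebra_simps)
  then have "z = resolvent D A p (y - (q - p) *\<^sub>R z)"
    using resolvent_left_inverse[OF p z] by (simp add: scaleC_of_real)
  also have "\<dots> = resolvent D A p y - (q - p) *\<^sub>R resolvent D A p z"
    using bounded_linear_resolvent[OF p] by (simp add: linear_simps)
  finally show ?thesis by (simp add: z_def algebra_simps)
qed

text \<open>With both orders equal the power in front of the resolvent has exponent 0, so the
  transform of an orbit is the resolvent itself. For real l > \<omega> \<ge> 0 the principal power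
  is the real one.\<close>

lemma resolvent_family_laplace:
  fixes S :: "real \<Rightarrow> 'a::complex_banach \<Rightarrow>\<^sub>L 'a"
  assumes S: "resolvent_family \<alpha> \<alpha> D A S" and int: "\<And>x. cont_loc_integrable (\<lambda>t. blinfun_apply (S t) x)"
  obtains \<omega> where "0 \<le> \<omega>" "\<And>l. \<omega> < l \<Longrightarrow> complex_of_real (l powr \<alpha>) \<in> resolvent_set D A"
    "\<And>l x. \<omega> < l \<Longrightarrow> laplace_to (\<lambda>t. blinfun_apply (S t) x) l (resolvent D A (complex_of_real (l powr \<alpha>)) x)"
proof -
  obtain \<omega> where \<omega>: "0 \<le> \<omega>" "\<And>l. \<omega> < Re l \<Longrightarrow> l powr complex_of_real \<alpha> \<in> resolvent_set D A \<and>
        (\<forall>x. ((\<lambda>t. exp (- l * complex_of_real t) *\<^sub>C blinfun_apply (S t) x) has_integral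
               l powr complex_of_real (\<alpha> - \<alpha>) *\<^sub>C resolvent D A (l powr complex_of_real \<alpha>) x) {0<..})"
    using S unfolding resolvent_family_def by blast
  have pw: "complex_of_real l powr complex_of_real \<alpha> = complex_of_real (l powr \<alpha>)" if "\<omega> < l" for l
    using that \<omega>(1) by (intro powr_of_real) auto
  show thesis
  proof (rule that[OF \<omega>(1)])
    fix l assume l: "\<omega> < l"
    then show "complex_of_real (l powr \<alpha>) \<in> resolvent_set D A"
      using \<omega>(2)[of "complex_of_real l"] pw by simp
    fix x
    have "exp (- complex_of_real l * complex_of_real t) = complex_of_real (exp (- l * t))" for t
      by (simp add: exp_of_real[symmetric])
    then have "((\<lambda>t. exp (- l * t) *\<^sub>R blinfun_apply (S t) x) has_integral
        resolvent D A (complex_of_real (l powr \<alpha>)) x) {0<..}"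
      using \<omega>(2)[of "complex_of_real l"] l \<omega>(1) pw[OF l] by (auto simp: scaleC_of_real scaleC_one)
    then show "laplace_to (\<lambda>t. blinfun_apply (S t) x) l (resolvent D A (complex_of_real (l powr \<alpha>)) x)"
      unfolding laplace_to_def
      by (rule tendsto_integral_half_line) (rule cont_loc_integrableD[OF cont_loc_integrable_exp[OF int]])
  qed
qed

text \<open>The resolvent identity reads R (l + h) x - R l x = - \<delta>(h) R l (R (l + h) x).
  Boundedness of R (l + h) x gives its continuity in h, and \<delta>(h) / h tends to \<alpha>
  l^(\<alpha>-1), the source of the factor \<alpha>. The derivative is taken from the right, where
  the bound is available.\<close>

lemma resolvent_powr_derivative:
  fixes A :: "'a::complex_banach \<Rightarrow> 'a"
  assumes res: "\<And>l'. l \<le> l' \<Longrightarrow> complex_of_real (l' powr \<alpha>) \<in> resolvent_set D A"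
    and bdd: "\<And>l'. l \<le> l' \<Longrightarrow> norm (resolvent D A (l' powr \<alpha>) x) \<le> C" and l: "0 < l"
  shows "((\<lambda>h. (resolvent D A ((l + h) powr \<alpha>) x - resolvent D A (l powr \<alpha>) x) /\<^sub>R h) \<longlongrightarrow>
      - (\<alpha> * l powr (\<alpha> - 1)) *\<^sub>R resolvent D A (l powr \<alpha>) (resolvent D A (l powr \<alpha>) x)) (at_right 0)"
proof -
  define R where "R l = resolvent D A (complex_of_real (l powr \<alpha>))" for l
  have R: "bounded_linear (R l)" unfolding R_def by (rule bounded_linear_resolvent[OF res]) simp
  define \<delta> where "\<delta> h = (l + h) powr \<alpha> - l powr \<alpha>" for h
  have id: "R (l + h) x - R l x = - (\<delta> h *\<^sub>R R l (R (l + h) x))" if "0 \<le> h" for h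
    using resolvent_identity[OF res[of l] res[of "l + h"], of x] that
    by (simp add: R_def \<delta>_def algebra_simps)
  have der: "((\<lambda>h. \<delta> h / h) \<longlongrightarrow> \<alpha> * l powr (\<alpha> - 1)) (at_right 0)"
  proof -
    have "((\<lambda>l. l powr \<alpha>) has_real_derivative \<alpha> * l powr (\<alpha> - 1)) (at l)"
      using l by (auto intro!: derivative_eq_intros)
    then have "((\<lambda>h. \<delta> h / h) \<longlongrightarrow> \<alpha> * l powr (\<alpha> - 1)) (at 0)"
      by (simp add: DERIV_def \<delta>_def)
    then show ?thesis by (rule tendsto_within_subset) simp
  qed
  have "((\<lambda>h. (l + h) powr \<alpha> - l powr \<alpha>) \<longlongrightarrow> (l + 0) powr \<alpha> - l powr \<alpha>) (at_right 0)"
    using l by (intro tendsto_intros) auto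
  then have \<delta>0: "(\<delta> \<longlongrightarrow> 0) (at_right 0)"
    by (simp add: \<delta>_def[abs_def])
  obtain K where K: "0 \<le> K" "\<And>y. norm (R l y) \<le> norm y * K"
    using bounded_linear.nonneg_bounded[OF R] by blast
  have R_cont: "((\<lambda>h. R (l + h) x) \<longlongrightarrow> R l x) (at_right 0)"
  proof -
    have "((\<lambda>h. \<bar>\<delta> h\<bar> * (C * K)) \<longlongrightarrow> \<bar>0\<bar> * (C * K)) (at_right 0)"
      by (intro tendsto_intros \<delta>0)
    then have lim: "((\<lambda>h. \<bar>\<delta> h\<bar> * (C * K)) \<longlongrightarrow> 0) (at_right 0)" by simp
    have "((\<lambda>h. R (l + h) x - R l x) \<longlongrightarrow> 0) (at_right 0)"
    proof (rule Lim_null_comparison[OF _ lim])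
      show "\<forall>\<^sub>F h in at_right 0. norm (R (l + h) x - R l x) \<le> \<bar>\<delta> h\<bar> * (C * K)"
        using eventually_at_right_less[of "0::real"]
      proof eventually_elim
        case (elim h)
        have "norm (R l (R (l + h) x)) \<le> norm (R (l + h) x) * K" by (rule K)
        also have "\<dots> \<le> C * K"
          using elim K bdd[of "l + h"] by (intro mult_right_mono) (auto simp: R_def)
        finally show ?case using elim by (simp add: id mult_left_mono)
      qed
    qed
    then show ?thesis by (rule LIM_zero_cancel)
  qed
  have "((\<lambda>h. - (\<delta> h / h) *\<^sub>R R l (R (l + h) x)) \<longlongrightarrow> - (\<alpha> * l powr (\<alpha> - 1)) *\<^sub>R R l (R l x)) (at_right 0)"
    by (intro tendsto_scaleR tendsto_minus der bounded_linear.tendsto[OF R] R_cont)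
  moreover have "\<forall>\<^sub>F h in at_right 0. - (\<delta> h / h) *\<^sub>R R l (R (l + h) x) = (R (l + h) x - R l x) /\<^sub>R h"
    using eventually_at_right_less[of "0::real"]
    by eventually_elim (simp add: id divide_inverse mult.commute)
  ultimately have "((\<lambda>h. (R (l + h) x - R l x) /\<^sub>R h) \<longlongrightarrow> - (\<alpha> * l powr (\<alpha> - 1)) *\<^sub>R R l (R l x)) (at_right 0)"
    by (rule Lim_transform_eventually)
  then show ?thesis by (simp add: R_def)
qed

section \<open>From transforms back to functions\<close>

lemma g_kernel_2: "0 \<le> t \<Longrightarrow> g_kernel 2 t = t"
  using Gamma_fact[of 1, where 'a = real] by (simp add: g_kernel_def)

text \<open>The paper's identity, after applying the resolvent at one fixed point \<open>\<mu>\<close> and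
  differentiating once.\<close>

lemma resolvent_order_identity:
  fixes D :: "'a::complex_banach set"
  assumes S: "resolvent_family \<alpha> \<alpha> D A S" and M: "majorized_family S m" and "\<alpha> \<noteq> 0"
    and C: "\<And>l. w < l \<Longrightarrow> \<exists>C. \<forall>N. integral {0..N} (\<lambda>t. exp (- l * t) * m t) \<le> C"
  shows "\<exists>\<mu>. complex_of_real \<mu> \<in> resolvent_set D A \<and> (\<forall>t>0. integral {0..t} (\<lambda>s. majorized_family.orbit_conv S x s
        - \<mu> *\<^sub>R resolvent D A \<mu> (majorized_family.orbit_conv S x s) - resolvent D A \<mu> (blinfun_apply (S s) x))
      + (1 / \<alpha>) *\<^sub>R resolvent D A \<mu> (t *\<^sub>R blinfun_apply (S t) x) = 0)"
proof -
  interpret majorized_family S m by (rule M)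
  obtain \<omega> where \<omega>: "0 \<le> \<omega>" and res: "\<And>l. \<omega> < l \<Longrightarrow> complex_of_real (l powr \<alpha>) \<in> resolvent_set D A"
    and lap: "\<And>l x. \<omega> < l \<Longrightarrow> laplace_to (\<lambda>t. blinfun_apply (S t) x) l (resolvent D A (complex_of_real (l powr \<alpha>)) x)"
    using resolvent_family_laplace[OF S orbit] by blast
  \<comment> \<open>Above \<open>\<omega>\<close> for the resolvents, above \<open>w\<close> for a
    finite weighted mass, and positive so that dividing by l is allowed.\<close>
  define l\<^sub>0 where "l\<^sub>0 = max \<omega> w + 1"
  have l\<^sub>0: "\<omega> < l\<^sub>0" "w < l\<^sub>0" "0 < l\<^sub>0" using \<omega> by (auto simp: l\<^sub>0_def)
  obtain C\<^sub>0 where C\<^sub>0: "\<And>N. integral {0..N} (\<lambda>t. exp (- l\<^sub>0 * t) * m t) \<le> C\<^sub>0"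
    using C[OF l\<^sub>0(2)] by blast
  \<comment> \<open>The fixed point is taken on the curve l powr \<alpha>, where membership in the
    resolvent set is known.\<close>
  define \<mu> where "\<mu> = l\<^sub>0 powr \<alpha>"
  define R where "R l = resolvent D A (complex_of_real (l powr \<alpha>))" for l
  define R\<^sub>0 where "R\<^sub>0 = resolvent D A (complex_of_real \<mu>)"
  have res\<mu>: "complex_of_real \<mu> \<in> resolvent_set D A" unfolding \<mu>_def by (rule res[OF l\<^sub>0(1)])
  have R: "bounded_linear (R l)" if "\<omega> < l" for l
    unfolding R_def by (rule bounded_linear_resolvent[OF res[OF that]])
  have R\<^sub>0: "bounded_linear R\<^sub>0" unfolding R\<^sub>0_def by (rule bounded_linear_resolvent[OF res\<mu>])
  have lapR: "laplace_to (\<lambda>t. blinfun_apply (S t) x) l (R l x)" if "l\<^sub>0 \<le> l" for l x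
    unfolding R_def using that l\<^sub>0 by (intro lap) auto
  show ?thesis
  proof (intro exI conjI allI impI)
    show "complex_of_real \<mu> \<in> resolvent_set D A" by (rule res\<mu>)
    fix t :: real assume t: "0 < t"
    define u where "u t = blinfun_apply (S t) x" for t
    define v where "v = orbit_conv x"
    \<comment> \<open>Formally v - \<mu> R0 v = - R0 A v, so \<open>a\<close> is R0 applied to - (A
      v + u), written without \<open>A\<close>; \<open>b\<close> is R0 applied to t u /
      \<alpha>.\<close>
    define a where "a t = v t - \<mu> *\<^sub>R R\<^sub>0 (v t) - R\<^sub>0 (u t)" for t
    define b where "b t = (1 / \<alpha>) *\<^sub>R R\<^sub>0 (t *\<^sub>R u t)" for t
    have bl: "bounded_linear (\<lambda>y. \<mu> *\<^sub>R R\<^sub>0 y)" "bounded_linear (\<lambda>y. (1 / \<alpha>) *\<^sub>R R\<^sub>0 y)"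
      by (intro bounded_linear_compose[OF bounded_linear_scaleR_right R\<^sub>0])+
    have u: "cont_loc_integrable u" unfolding u_def by (rule orbit)
    have v: "cont_loc_integrable v" unfolding v_def by (rule orbit_conv_cont_loc_integrable)
    have tu: "cont_loc_integrable (\<lambda>t. t *\<^sub>R u t)" by (rule cont_loc_integrable_times_id[OF u])
    note i = cont_loc_integrable_bounded_linear[OF bl(1) v] cont_loc_integrable_bounded_linear[OF R\<^sub>0 u]
    have a: "cont_loc_integrable a"
      unfolding a_def by (intro cont_loc_integrable_diff v i)
    have b: "cont_loc_integrable b"
      unfolding b_def by (rule cont_loc_integrable_bounded_linear[OF bl(2) tu])
    have Lv: "laplace_to v l (R l (R l x))" if l: "l\<^sub>0 \<le> l" for l
    proof -
      obtain C' where "\<And>N. integral {0..N} (\<lambda>t. exp (- l * t) * m t) \<le> C'"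
        using C[of l] l l\<^sub>0 by auto
      then show ?thesis
        unfolding v_def using l l\<^sub>0 by (intro laplace_orbit_conv R lapR) auto
    qed
    have La: "laplace_to a l (- (l powr \<alpha>) *\<^sub>R R\<^sub>0 (R l (R l x)))" if l: "l\<^sub>0 \<le> l" for l
    proof -
      have "laplace_to a l (R l (R l x) - \<mu> *\<^sub>R R\<^sub>0 (R l (R l x)) - R\<^sub>0 (R l x))"
        unfolding a_def u_def
        by (intro laplace_to_diff v laplace_to_bounded_linear[OF bl(1) v] laplace_to_bounded_linear[OF R\<^sub>0]
            orbit Lv[OF l] lapR[OF l] i(1) i(2)[unfolded u_def] cont_loc_integrable_diff)
      \<comment> \<open>The resolvent identity between \<mu> and l powr \<alpha>, applied to R l x,
        cancels the terms carrying \<mu> and leaves only the power of l.\<close>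
      moreover have "R\<^sub>0 (R l x) - R l (R l x) = (l powr \<alpha> - \<mu>) *\<^sub>R R\<^sub>0 (R l (R l x))"
        using resolvent_identity[OF res\<mu> res[of l], of "R l x"] l l\<^sub>0 by (simp add: R\<^sub>0_def R_def)
      then have "R l (R l x) - \<mu> *\<^sub>R R\<^sub>0 (R l (R l x)) - R\<^sub>0 (R l x) = - (l powr \<alpha>) *\<^sub>R R\<^sub>0 (R l (R l x))"
        by (simp add: algebra_simps)
      ultimately show ?thesis by simp
    qed
    have Lb: "laplace_to b l (l powr (\<alpha> - 1) *\<^sub>R R\<^sub>0 (R l (R l x)))" if l: "l\<^sub>0 < l" for l
    proof -
      have "laplace_to (\<lambda>t. t *\<^sub>R u t) l ((\<alpha> * l powr (\<alpha> - 1)) *\<^sub>R R l (R l x))"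
        unfolding u_def
      proof (rule laplace_times_id[OF C\<^sub>0 l, where \<phi> = "\<lambda>l. R l x"])
        show "laplace_to (\<lambda>t. blinfun_apply (S t) x) l' (R l' x)" if "l \<le> l'" for l'
          using that l by (intro lapR) simp
        have "norm (R l' x) \<le> C\<^sub>0 * norm x" if "l \<le> l'" for l'
          using that l by (intro norm_laplace_le[OF C\<^sub>0 _ lapR]) auto
        then show "((\<lambda>h. (R (l + h) x - R l x) /\<^sub>R h) \<longlongrightarrow> - ((\<alpha> * l powr (\<alpha> - 1)) *\<^sub>R R l (R l x))) (at_right 0)"
          using resolvent_powr_derivative[of l \<alpha> D A x "C\<^sub>0 * norm x"] res l l\<^sub>0 by (simp add: R_def)
      qed
      from laplace_to_bounded_linear[OF bl(2) tu this] show ?thesis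
        using \<open>\<alpha> \<noteq> 0\<close> bounded_linear.linear[OF R\<^sub>0] by (simp add: b_def[abs_def] linear_scale)
    qed
    \<comment> \<open>Starting at \<open>l\<^sub>0 + 1\<close> keeps every l strictly above
      \<open>l\<^sub>0\<close>: the transform of \<open>a\<close> at \<open>l\<^sub>0\<close>
      controls the growth of its primitive, and the gap is also what \<open>laplace_times_id\<close>
      needs.\<close>
    have "integral {0..t} a + b t = 0"
    proof (rule lerch[OF _ _ t, where l = "l\<^sub>0 + 1"])
      show "cont_loc_integrable (\<lambda>t. integral {0..t} a + b t)"
        by (intro cont_loc_integrable_add primitive_cont_loc_integrable a b)
      fix n :: nat
      define l where "l = l\<^sub>0 + 1 + real n"
      have l: "l\<^sub>0 < l" "0 < l" using l\<^sub>0 by (auto simp: l_def)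
      have "laplace_to (\<lambda>t. integral {0..t} a) l ((- (l powr \<alpha>) *\<^sub>R R\<^sub>0 (R l (R l x))) /\<^sub>R l)"
        using l l\<^sub>0 by (intro laplace_to_primitive[OF a _ l(1) La La]) auto
      then have "laplace_to (\<lambda>t. integral {0..t} a + b t) l
          ((- (l powr \<alpha>) *\<^sub>R R\<^sub>0 (R l (R l x))) /\<^sub>R l + l powr (\<alpha> - 1) *\<^sub>R R\<^sub>0 (R l (R l x)))"
        by (intro laplace_to_add primitive_cont_loc_integrable a b Lb l(1))
      \<comment> \<open>Here the two sides cancel: integrating \<open>a\<close> has divided its
        transform by l.\<close>
      moreover have "l powr (\<alpha> - 1) = l powr \<alpha> / l" using l(2) by (simp add: powr_diff)
      ultimately show "laplace_to (\<lambda>t. integral {0..t} a + b t) (l\<^sub>0 + 1 + real n) 0"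
        by (simp add: l_def divide_inverse mult.commute)
    qed
    then show "integral {0..t} (\<lambda>s. orbit_conv x s - \<mu> *\<^sub>R resolvent D A \<mu> (orbit_conv x s)
          - resolvent D A \<mu> (blinfun_apply (S s) x))
        + (1 / \<alpha>) *\<^sub>R resolvent D A \<mu> (t *\<^sub>R blinfun_apply (S t) x) = 0"
      by (simp add: a_def[abs_def] b_def u_def v_def R\<^sub>0_def)
  qed
qed

theorem theorem13:
  fixes \<alpha> T :: real
    and D :: "'a::complex_banach set"
    and A :: "'a \<Rightarrow> 'a"
    and S :: "real \<Rightarrow> 'a \<Rightarrow>\<^sub>L 'a"
    and u :: "real \<Rightarrow> 'a"
    and x :: 'a
  assumes "0 < \<alpha>" and "\<alpha> < 1"
    and "closed_linear_operator D A"
    and "resolvent_family \<alpha> \<alpha> D A S"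
    and "T > 0"
    and "\<And>t. t > 0 \<Longrightarrow> u t = blinfun_apply (S t) x"
  shows "(\<forall>t\<in>{0..T}. convolution_exists blinfun_apply S u t) \<and>
    convolution_exists scaleR (g_kernel 2) (convolution blinfun_apply S u) T \<and>
    convolution_exists scaleR (g_kernel 2) u T \<and>
    convolution scaleR (g_kernel 2) (convolution blinfun_apply S u) T \<in> D \<and>
    psi A S T x =
      A (convolution scaleR (g_kernel 2) (convolution blinfun_apply S u) T)
      + convolution scaleR (g_kernel 2) u T \<and>
    ((\<lambda>r. r *\<^sub>R u r) has_integral \<alpha> *\<^sub>R psi A S T x) {0..T}"
proof -
  note S = \<open>resolvent_family \<alpha> \<alpha> D A S\<close> and uS = assms(6)
  have "strongly_continuous S" "exponentially_bounded S"
    using S by (simp_all add: resolvent_family_def)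
  then obtain m \<omega> where M: "majorized_family S m"
    and C: "\<And>l. \<omega> < l \<Longrightarrow> \<exists>C. \<forall>N. integral {0..N} (\<lambda>t. exp (- l * t) * m t) \<le> C"
    using exponentially_bounded_imp_majorized by blast
  interpret majorized_family S m by (rule M)
  define v where "v = orbit_conv x"
  have v: "cont_loc_integrable v" unfolding v_def by (rule orbit_conv_cont_loc_integrable)
  obtain \<mu> where \<mu>: "complex_of_real \<mu> \<in> resolvent_set D A"
    and id: "\<And>t. 0 < t \<Longrightarrow> integral {0..t} (\<lambda>s. v s - \<mu> *\<^sub>R resolvent D A \<mu> (v s) - resolvent D A \<mu> (blinfun_apply (S s) x))
      + (1 / \<alpha>) *\<^sub>R resolvent D A \<mu> (t *\<^sub>R blinfun_apply (S t) x) = 0"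
    using resolvent_order_identity[OF S M less_imp_neq[OF \<open>0 < \<alpha>\<close>, symmetric] C, where x = x, folded v_def]
    by blast
  define R where "R = resolvent D A (complex_of_real \<mu>)"
  have R: "bounded_linear R" unfolding R_def by (rule bounded_linear_resolvent[OF \<mu>])

  \<comment> \<open>In terms of convolutions, \<open>p\<close> is (g_2 * u)(T) and \<open>w\<close>
    is (g_2 * S * u)(T); \<open>z\<close> is the left-hand side of the claim.\<close>
  define p where "p = integral {0..T} (\<lambda>s. (T - s) *\<^sub>R blinfun_apply (S s) x)"
  define w where "w = integral {0..T} (\<lambda>s. (T - s) *\<^sub>R v s)"
  define z where "z = integral {0..T} (\<lambda>s. s *\<^sub>R blinfun_apply (S s) x)"
  have T: "0 \<le> T" using \<open>T > 0\<close> by simp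
  have p: "((\<lambda>s. (T - s) *\<^sub>R blinfun_apply (S s) x) has_integral p) {0..T}"
    unfolding p_def using integral_primitive[OF orbit T] by (blast intro: integrable_integral)
  have w: "((\<lambda>s. (T - s) *\<^sub>R v s) has_integral w) {0..T}"
    unfolding w_def using integral_primitive[OF v T] by (blast intro: integrable_integral)
  have z: "((\<lambda>s. s *\<^sub>R blinfun_apply (S s) x) has_integral z) {0..T}"
    unfolding z_def
    by (intro integrable_integral cont_loc_integrableD cont_loc_integrable_times_id orbit)

  \<comment> \<open>The double primitive of \<open>a\<close> is computed in two ways: with the
    weight T - s, which produces w, R w and R p, and from the identity \<open>id\<close> for its
    single primitive, which produces R z. Solving for \<open>w\<close> exhibits it as a value of
    R.\<close>
  have key: "w = R (\<mu> *\<^sub>R w + p - (1 / \<alpha>) *\<^sub>R z)"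
  proof -
    define a where "a s = v s - \<mu> *\<^sub>R R (v s) - R (blinfun_apply (S s) x)" for s
    have bl: "bounded_linear (\<lambda>y. \<mu> *\<^sub>R R y)"
      by (intro bounded_linear_compose[OF bounded_linear_scaleR_right R])
    have a: "cont_loc_integrable a"
      unfolding a_def
      by (intro cont_loc_integrable_diff v cont_loc_integrable_bounded_linear[OF bl v]
          cont_loc_integrable_bounded_linear[OF R orbit])
    have "((\<lambda>s. (T - s) *\<^sub>R a s) has_integral w - \<mu> *\<^sub>R R w - R p) {0..T}"
      using has_integral_diff[OF has_integral_diff[OF w has_integral_linear[OF w bl]] has_integral_linear[OF p R]]
      using bounded_linear.linear[OF R]
      by (simp add: o_def a_def linear_scale scaleR_diff_right mult.commute)
    moreover have "((\<lambda>s. (T - s) *\<^sub>R a s) has_integral integral {0..T} (\<lambda>t. integral {0..t} a)) {0..T}"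
      by (rule integral_primitive[OF a T])
    moreover have "integral {0..T} (\<lambda>t. integral {0..t} a)
        = integral {0..T} (\<lambda>t. - ((1 / \<alpha>) *\<^sub>R R (t *\<^sub>R blinfun_apply (S t) x)))"
    proof (rule integral_cong)
      fix t assume "t \<in> {0..T}"
      then consider "t = 0" | "0 < t" by fastforce
      then show "integral {0..t} a = - ((1 / \<alpha>) *\<^sub>R R (t *\<^sub>R blinfun_apply (S t) x))"
      proof cases
        case 1
        then show ?thesis using bounded_linear.linear[OF R] by (simp add: linear_0)
      next
        case 2
        then show ?thesis
          using id[OF 2] by (simp add: a_def[abs_def] R_def eq_neg_iff_add_eq_0)
      qed
    qed
    moreover have "\<dots> = - ((1 / \<alpha>) *\<^sub>R R z)"
      using integral_unique[OF has_integral_neg[OF has_integral_cmul[OF has_integral_linear[OF z R]]]]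
      by (simp add: o_def)
    ultimately have "w - \<mu> *\<^sub>R R w - R p = - ((1 / \<alpha>) *\<^sub>R R z)"
      using has_integral_unique by metis
    then show ?thesis
      using bounded_linear.linear[OF R] by (simp add: linear_add linear_diff linear_scale algebra_simps)
  qed
  \<comment> \<open>Membership in the domain is read off from the range of the resolvent; applying
    \<mu> - A to \<open>key\<close> then recovers A w.\<close>
  have wD: "w \<in> D"
    by (subst key) (simp add: R_def resolvent_in_domain[OF \<mu>])
  have "\<mu> *\<^sub>R w - A w = \<mu> *\<^sub>R w + p - (1 / \<alpha>) *\<^sub>R z"
    using resolvent_right_inverse[OF \<mu>, of "\<mu> *\<^sub>R w + p - (1 / \<alpha>) *\<^sub>R z"] key
    by (simp add: R_def scaleC_of_real)
  then have "A w + p = (1 / \<alpha>) *\<^sub>R z" by (simp add: algebra_simps)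
  then have Aw: "\<alpha> *\<^sub>R (A w + p) = z" using \<open>0 < \<alpha>\<close> by simp

  \<comment> \<open>\<open>u\<close> is tied to the orbit only for t > 0; the single point 0 does
    not affect the integrals.\<close>
  have spike: "integral {0..t} (\<lambda>s. g (t - s) (u s)) = integral {0..t} (\<lambda>s. g (t - s) (blinfun_apply (S s) x))"
    for t and g :: "real \<Rightarrow> 'a \<Rightarrow> 'a"
    by (rule integral_spike[of "{0}"]) (auto simp: uS)
  have spike_integrable: "(\<lambda>s. g (t - s) (u s)) integrable_on {0..t}"
    if "(\<lambda>s. g (t - s) (blinfun_apply (S s) x)) integrable_on {0..t}" for t and g :: "real \<Rightarrow> 'a \<Rightarrow> 'a"
    by (rule integrable_spike[OF that, of "{0}"]) (auto simp: uS)
  have conv_v: "convolution blinfun_apply S u = v" "op_convolution blinfun_apply S (\<lambda>s. blinfun_apply (S s)) t x = v t" for t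
    using spike[of _ "\<lambda>s. blinfun_apply (S s)"]
    by (auto simp: convolution_def op_convolution_def v_def orbit_conv_def)
  have g2: "integral {0..T} (\<lambda>s. g_kernel 2 (T - s) *\<^sub>R f s) = integral {0..T} (\<lambda>s. (T - s) *\<^sub>R f s)" for f :: "real \<Rightarrow> 'a"
    by (intro integral_cong) (simp add: g_kernel_2)
  have g2i: "(\<lambda>s. g_kernel 2 (T - s) *\<^sub>R f s) integrable_on {0..T}" if "(\<lambda>s. (T - s) *\<^sub>R f s) integrable_on {0..T}" for f :: "real \<Rightarrow> 'a"
    by (rule integrable_eq[OF that]) (simp add: g_kernel_2)
  have conv_w: "convolution scaleR (g_kernel 2) v T = w"
    by (simp add: convolution_def g2 w_def)
  have conv_p: "convolution scaleR (g_kernel 2) u T = p"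
    "op_convolution scaleR (g_kernel 2) (\<lambda>s. blinfun_apply (S s)) T x = p"
    using spike[of T "\<lambda>s. scaleR (g_kernel 2 s)"] by (auto simp: convolution_def op_convolution_def g2 p_def)
  have psi: "psi A S T x = A w + p"
    using conv_v(2) conv_w conv_p(2) by (simp add: psi_def op_convolution_def[of scaleR])
  show ?thesis
  proof (intro conjI ballI)
    show "convolution_exists blinfun_apply S u t" for t
      unfolding convolution_exists_def by (rule spike_integrable[OF integrable_twice])
    show "convolution_exists scaleR (g_kernel 2) (convolution blinfun_apply S u) T"
      unfolding convolution_exists_def conv_v(1) by (rule g2i) (rule has_integral_integrable[OF w])
    show "convolution_exists scaleR (g_kernel 2) u T"
      unfolding convolution_exists_def by (rule spike_integrable[OF g2i]) (rule has_integral_integrable[OF p])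
    show "convolution scaleR (g_kernel 2) (convolution blinfun_apply S u) T \<in> D"
      unfolding conv_v(1) conv_w by (rule wD)
    show "psi A S T x = A (convolution scaleR (g_kernel 2) (convolution blinfun_apply S u) T)
        + convolution scaleR (g_kernel 2) u T"
      by (simp add: conv_v(1) conv_w conv_p(1) psi)
    show "((\<lambda>r. r *\<^sub>R u r) has_integral \<alpha> *\<^sub>R psi A S T x) {0..T}"
      unfolding psi Aw by (rule has_integral_spike_finite[OF _ _ z, of "{0}"]) (auto simp: uS)
  qed
qed

end
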